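(* Let $m,n,d,e,k$ be positive integers with $m=2n$, $e=\gcd(n,d)=\gcd(m,d)$ and $1\le k\le\frac{n}{e}$, and let $B_{\vec a}$ be as in the context. For even $r$ with $0\le r\le m/e$, let \[\beta_r=2^{-m}\#\{\vec a\in\mathbb{F}_{2^n}\times\mathbb{F}_{2^m}^k\mid {\rm rk}(B_{\vec a})=r,\ (a_0,a_1,\dots,a_{k-1})\ne0\}.\] Then for each $j=0,1,\dots,k-1$, \[\beta_{\frac{m}{e}-2j}=\sum_{v=j}^{k-1}(-1)^{v-j}4^{e\binom{v-j}{2}}\binom{v}{j}_{4^e}\binom{\frac{m}{2e}}{v}_{4^e}\big(2^{n(2k-1-2v)+ev}-1\big).\]
   Context: For $\vec a=(a_0,\dots,a_k)\in\mathbb{F}_{2^n}\times\mathbb{F}_{2^m}^k$, $B_{\vec a}$ is the $\mathbb{F}_{2^e}$-bilinear form on $\mathbb{F}_{2^m}$ given by \[B_{\vec a}(x,y)={\rm Tr}_{\mathbb{F}_{2^n}/\mathbb{F}_{2^e}}\big(a_0(xy^{2^{nd/e}}+x^{2^{nd/e}}y)\big)+\sum_{j=1}^{k-1}{\rm Tr}_{\mathbb{F}_{2^m}/\mathbb{F}_{2^e}}\big(a_j(xy^{2^{(\frac{n}{e}-j)d}}+x^{2^{(\frac{n}{e}-j)d}}y)\big).\] Its rank ${\rm rk}(B_{\vec a})$ is $m/e$ minus the $\mathbb{F}_{2^e}$-dimension of $\{x\mid B_{\vec a}(x,y)=0\ \forall y\}$. $\binom{a}{b}_q$ is the Gaussian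 binomial coefficient and $\binom{a}{2}=a(a-1)/2$. *)

theory Defs
  imports Complex_Main
begin

text \<open>The ambient field is a finite field 'a with CARD('a) = 2^m, playing the role of F_{2^m}.
  Subfields are fixed-point sets of Frobenius powers.\<close>

definition subfield_of_order :: "nat \<Rightarrow> 'a::field set" where
  "subfield_of_order t = {x. x ^ (2 ^ t) = x}"

definition trace2 :: "nat \<Rightarrow> nat \<Rightarrow> 'a::field \<Rightarrow> 'a" where
  "trace2 s e x = (\<Sum>i<s div e. x ^ (2 ^ (e * i)))"

definition Bform :: "nat \<Rightarrow> nat \<Rightarrow> nat \<Rightarrow> nat \<Rightarrow> nat \<Rightarrow> (nat \<Rightarrow> 'a::field) \<Rightarrow> 'a \<Rightarrow> 'a \<Rightarrow> 'a" where
  "Bform m n d e k a x y =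
     trace2 n e (a 0 * (x * y ^ (2 ^ (n * d div e)) + x ^ (2 ^ (n * d div e)) * y))
     + (\<Sum>j\<in>{1..<k}. trace2 m e (a j * (x * y ^ (2 ^ ((n div e - j) * d))
                                         + x ^ (2 ^ ((n div e - j) * d)) * y)))"

definition Brad :: "nat \<Rightarrow> nat \<Rightarrow> nat \<Rightarrow> nat \<Rightarrow> nat \<Rightarrow> (nat \<Rightarrow> 'a::{field,finite}) \<Rightarrow> 'a set" where
  "Brad m n d e k a = {x. \<forall>y. Bform m n d e k a x y = 0}"

definition dim_over :: "nat \<Rightarrow> 'b set \<Rightarrow> nat" where
  "dim_over q S = (THE t. card S = q ^ t)"

definition Brank :: "nat \<Rightarrow> nat \<Rightarrow> nat \<Rightarrow> nat \<Rightarrow> nat \<Rightarrow> (nat \<Rightarrow> 'a::{field,finite}) \<Rightarrow> nat" where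
  "Brank m n d e k a = m div e - dim_over (2 ^ e) (Brad m n d e k a)"

definition gauss_binom :: "real \<Rightarrow> nat \<Rightarrow> nat \<Rightarrow> real" where
  "gauss_binom q a b = (if b \<le> a then (\<Prod>i<b. q ^ (a - i) - 1) / (\<Prod>i<b. q ^ (i + 1) - 1) else 0)"

text \<open>beta_r: vectors a = (a_0,...,a_k) with a_0 in F_{2^n}, a_i in F_{2^m}, encoded as
  functions nat => 'a vanishing beyond k.\<close>
definition beta :: "'a::{field,finite} itself \<Rightarrow> nat \<Rightarrow> nat \<Rightarrow> nat \<Rightarrow> nat \<Rightarrow> nat \<Rightarrow> nat \<Rightarrow> real" where
  "beta _ m n d e k r = real (card {a :: nat \<Rightarrow> 'a.
        a 0 \<in> subfield_of_order n \<and> (\<forall>i>k. a i = 0) \<and>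
        Brank m n d e k a = r \<and> (\<exists>i<k. a i \<noteq> 0)}) / 2 ^ m"

end

theory Submission
  imports Defs "HOL-Number_Theory.Residues" "HOL-Computational_Algebra.Polynomial"
    "HOL-Library.Function_Algebras"
begin

text \<open>Write \<open>q = 2\<^sup>e\<close>, \<open>M = n/e\<close>, and let \<open>\<sigma> x = x\<close> to the power \<open>2\<^sup>d\<close>, a generator of the
  Galois group over the field \<open>K\<close> of order \<open>q\<close>. The radical of \<open>B\<^sub>a\<close> is the kernel of a skew
  polynomial in \<open>\<sigma>\<close> supported on the exponents from \<open>M - k + 1\<close> to \<open>M + k - 1\<close>, so it has dimension
  at most \<open>2 (k - 1)\<close> unless \<open>a = 0\<close>, and this dimension is even because \<open>B\<^sub>a\<close> is alternating.

  Dually, a bivector \<open>\<Sum>\<^sub>i x\<^sub>i \<and> y\<^sub>i\<close> of rank at most \<open>2 (k - 1)\<close> annihilated by all \<open>B\<^sub>a\<close> gives a skew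
  polynomial supported on the complementary window, whose rank would be at least \<open>2 k\<close>; hence the
  bivector is zero. Counting pairs, the number of \<open>a\<close> whose radical contains \<open>v < k\<close> given
  independent vectors is the same as if \<open>B\<^sub>a\<close> were a uniformly random alternating form. This fixes
  the average over \<open>a\<close> of every polynomial of degree less than \<open>k\<close> in \<open>|rad B\<^sub>a|\<close>. Evaluating it on
  \<open>\<Prod>i<v. X - q\<^bsup>2i\<^esup>\<close> gives the binomial moments of the rank distribution in base \<open>q\<^sup>2 = 4\<^sup>e\<close>, and
  Gaussian inversion yields the formula.\<close>

section \<open>Moments of the radical of an alternating form\<close>

text \<open>For \<open>z = q\<^bsup>-N\<^esup>\<close>, \<open>rad_moment q t z\<close> is the \<open>t\<close>-th moment of the number of radical vectors of
  a random alternating form on an \<open>N\<close>-dimensional space; the recursion conditions on one radical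
  vector and passes to the quotient by it.\<close>

primrec rad_moment :: "real \<Rightarrow> nat \<Rightarrow> real \<Rightarrow> real" where
  "rad_moment q 0 z = 1"
| "rad_moment q (Suc t) z = rad_moment q t z + q ^ Suc t * (1 - z) * rad_moment q t (q * z)"

text \<open>Linear extension of sending \<open>X ^ t\<close> to the \<open>t\<close>-th moment:
  \<open>P\<close> goes to the expected value of \<open>P\<close> at the number of radical vectors
  of the random form.\<close>

definition moment_functional :: "real \<Rightarrow> real \<Rightarrow> real poly \<Rightarrow> real" where
  "moment_functional q z P = (\<Sum>t\<le>degree P. coeff P t * rad_moment q t z)"

lemma moment_functional_eq:
  assumes "degree P \<le> D"
  shows "moment_functional q z P = (\<Sum>t\<le>D. coeff P t * rad_moment q t z)"
  unfolding moment_functional_def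
  by (rule sum.mono_neutral_left) (use assms in \<open>auto simp: coeff_eq_0\<close>)

lemma moment_functional_add:
  "moment_functional q z (P + Q) = moment_functional q z P + moment_functional q z Q"
proof -
  let ?D = "max (degree P) (degree Q)"
  have "moment_functional q z (P + Q) = (\<Sum>t\<le>?D. coeff (P + Q) t * rad_moment q t z)"
    by (rule moment_functional_eq) (rule degree_add_le_max)
  then show ?thesis
    by (simp add: moment_functional_eq[of P ?D] moment_functional_eq[of Q ?D] sum.distrib algebra_simps)
qed

lemma moment_functional_smult:
  "moment_functional q z (smult c P) = c * moment_functional q z P"
  using moment_functional_eq[of "smult c P" "degree P" q z]
  by (simp add: moment_functional_def sum_distrib_left mult.assoc)

lemma moment_functional_1 [simp]: "moment_functional q z 1 = 1"
  by (simp add: moment_functional_def)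

text \<open>Multiplying by \<open>X - 1\<close> produces differences of consecutive moments, which
  the recursion of \<open>rad_moment\<close> rewrites at \<open>q * z\<close>. The remaining
  \<open>q ^ t\<close> is absorbed by substituting \<open>q X\<close> for \<open>X\<close>: the
  radical is \<open>q\<close> times as large as the one in the quotient.\<close>

lemma moment_functional_shift:
  "moment_functional q z ([:-1, 1:] * P) = q * (1 - z) * moment_functional q (q * z) (P \<circ>\<^sub>p [:0, q:])"
proof -
  let ?D = "degree P"
  have c: "coeff (P \<circ>\<^sub>p [:0, q:]) t = q ^ t * coeff P t" for t
    by (simp add: coeff_pcompose_linear)
  have d: "degree (P \<circ>\<^sub>p [:0, q:]) \<le> ?D"
    by (rule order.trans[OF degree_pcompose_le]) (simp)
  have X: "moment_functional q z (pCons 0 P) = (\<Sum>t\<le>?D. coeff P t * rad_moment q (Suc t) z)"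
    by (subst moment_functional_eq[of _ "Suc ?D"])
       (simp_all add: degree_pCons_le sum.atMost_Suc_shift del: sum.atMost_Suc)
  have "moment_functional q z ([:-1, 1:] * P) = moment_functional q z (pCons 0 P + smult (-1) P)"
    by simp
  also have "\<dots> = (\<Sum>t\<le>?D. coeff P t * (rad_moment q (Suc t) z - rad_moment q t z))"
    unfolding moment_functional_add moment_functional_smult X
    by (simp add: moment_functional_def right_diff_distrib sum_subtractf del: rad_moment.simps)
  also have "\<dots> = q * (1 - z) * moment_functional q (q * z) (P \<circ>\<^sub>p [:0, q:])"
    by (simp add: moment_functional_eq[OF d] sum_distrib_left c mult_ac)
  finally show ?thesis .
qed

lemma pcompose_root_prod:
  fixes q :: "'a::idom"
  shows "(\<Prod>i<v. [:-(q * f i), 1:]) \<circ>\<^sub>p [:0, q:] = smult (q ^ v) (\<Prod>i<v. [:-f i, 1:])"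
proof (induction v)
  case (Suc v)
  have "[:-(q * f v), 1:] \<circ>\<^sub>p [:0, q:] = smult q [:-f v, 1:]"
    by (simp add: pcompose_pCons)
  with Suc show ?case
    by (simp only: prod.lessThan_Suc pcompose_mult mult_smult_left mult_smult_right smult_smult
        power_Suc mult.commute[of "q ^ v" q])
qed (simp add: pcompose_1)

text \<open>At the size of a radical this polynomial counts ordered independent
  \<open>v\<close>-tuples. Splitting off the root 1 and shifting divides the other roots by
  \<open>q\<close>, so induction applies at \<open>q * z\<close>.\<close>

lemma moment_functional_q_factorial:
  "moment_functional q z (\<Prod>i<v. [:-(q ^ i), 1:]) = (\<Prod>i<v. q ^ Suc i * (1 - q ^ i * z))"
proof (induction v arbitrary: z)
  case (Suc v)
  have "(\<Prod>i<Suc v. [:-(q ^ i), 1:]) = [:-1, 1:] * (\<Prod>i<v. [:-(q * q ^ i), 1:])"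
    by (simp only: prod.lessThan_Suc_shift) simp
  then have "moment_functional q z (\<Prod>i<Suc v. [:-(q ^ i), 1:])
      = q * (1 - z) * (q ^ v * (\<Prod>i<v. q ^ Suc i * (1 - q ^ i * (q * z))))"
    by (simp only: moment_functional_shift pcompose_root_prod moment_functional_smult Suc)
  also have "\<dots> = (\<Prod>i<Suc v. q ^ Suc i) * (\<Prod>i<Suc v. 1 - q ^ i * z)"
    by (simp only: prod.distrib prod.lessThan_Suc_shift[of "\<lambda>i. 1 - q ^ i * z"] prod.lessThan_Suc)
       (simp add: mult_ac)
  finally show ?case by (simp only: prod.distrib)
qed simp

text \<open>The even roots \<open>q ^ (2 * i)\<close> are the possible radical sizes. Removing the
  root 1 and rescaling turns even exponents into odd ones, so the two families need a simultaneous
  induction.\<close>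

lemma moment_functional_sq_factorial:
  "moment_functional q z (\<Prod>i<v. [:-(q ^ (2 * i)), 1:]) = q ^ v * (\<Prod>i<v. 1 - q ^ (2 * i) * z)"
  "moment_functional q z (\<Prod>i<v. [:-(q * q ^ (2 * i)), 1:]) = (\<Prod>i<v. 1 - q ^ (2 * i) * (q * z))"
proof (induction v arbitrary: z)
  case (Suc v)
  {
    case 1
    have "(\<Prod>i<Suc v. [:-(q ^ (2 * i)), 1:]) = [:-1, 1:] * (\<Prod>i<v. [:-(q * (q * q ^ (2 * i))), 1:])"
      by (simp only: prod.lessThan_Suc_shift) simp
    then have "moment_functional q z (\<Prod>i<Suc v. [:-(q ^ (2 * i)), 1:])
        = q * (1 - z) * (q ^ v * (\<Prod>i<v. 1 - q ^ (2 * i) * (q * (q * z))))"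
      by (simp only: moment_functional_shift pcompose_root_prod moment_functional_smult Suc)
    then show ?case
      by (simp only: prod.lessThan_Suc_shift) (simp add: mult_ac)
  next
    case 2
    let ?R = "\<Prod>i<v. [:-(q * q ^ (2 * i)), 1:]"
    have "(\<Prod>i<Suc v. [:-(q * q ^ (2 * i)), 1:]) = ?R * [:-(q * q ^ (2 * v)), 1:]"
      by simp
    \<comment> \<open>The root 1 is absent here, so the last factor is split as \<open>X - 1\<close>
      plus a constant; the first summand then falls under claim 1 at \<open>q * z\<close>, the
      second under claim 2 at \<open>z\<close>.\<close>
    also have "[:-(q * q ^ (2 * v)), 1:] = [:-1, 1:] + [:1 - q * q ^ (2 * v):]"
      by simp
    also have "?R * \<dots> = [:-1, 1:] * ?R + smult (1 - q * q ^ (2 * v)) ?R"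
      by (simp add: smult_add_left[symmetric] algebra_simps)
    finally have "moment_functional q z (\<Prod>i<Suc v. [:-(q * q ^ (2 * i)), 1:])
        = q * (1 - z) * (q ^ v * (q ^ v * (\<Prod>i<v. 1 - q ^ (2 * i) * (q * z))))
          + (1 - q * q ^ (2 * v)) * (\<Prod>i<v. 1 - q ^ (2 * i) * (q * z))"
      by (simp only: moment_functional_add moment_functional_shift pcompose_root_prod
          moment_functional_smult Suc)
    also have "\<dots> = (\<Prod>i<v. 1 - q ^ (2 * i) * (q * z)) * (1 - q ^ (2 * v) * (q * z))"
    proof -
      have "q * (1 - z) * (a * (a * b)) + (1 - q * (a * a)) * b = b * (1 - a * a * (q * z))" for a b
        by (simp add: algebra_simps)
      then show ?thesis by (simp only: mult_2 power_add)
    qed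
    finally show ?case by simp
  }
qed simp_all

section \<open>Comparing functionals on a basis of monic polynomials\<close>

lemma degree_root_prod: "degree (\<Prod>i<v. [:-(f i :: real), 1:]) = v"
  by (induction v) (simp_all add: degree_mult_eq prod_zero_iff del: mult_pCons_right mult_pCons_left)

lemma coeff_root_prod: "coeff (\<Prod>i<v. [:-(f i :: real), 1:]) v = 1"
proof -
  have "lead_coeff (\<Prod>i<v. [:-f i, 1:]) = 1"
    by (induction v) (simp_all only: prod.lessThan_Suc lead_coeff_mult, simp_all)
  then show ?thesis by (simp only: degree_root_prod)
qed

text \<open>Subtracting the leading coefficient times \<open>b (Suc D)\<close> lowers the degree
  bound, so one monic polynomial in each degree suffices as test set.\<close>

lemma linear_functionals_agree:
  fixes F G :: "real poly \<Rightarrow> real"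
  assumes F: "\<And>P Q. F (P + Q) = F P + F Q" "\<And>c P. F (smult c P) = c * F P"
    and G: "\<And>P Q. G (P + Q) = G P + G Q" "\<And>c P. G (smult c P) = c * G P"
    and b: "\<And>v. v \<le> D \<Longrightarrow> degree (b v) = v \<and> coeff (b v) v = 1 \<and> F (b v) = G (b v)"
    and "degree P \<le> D"
  shows "F P = G P"
  using b \<open>degree P \<le> D\<close>
proof (induction D arbitrary: P)
  case 0
  then have "degree P = 0" "degree (b 0) = 0" "coeff (b 0) 0 = 1" by auto
  then have "P = smult (coeff P 0) (b 0)"
    by (metis degree_0_id mult.right_neutral smult_pCons smult_0_right)
  then show ?case
    using F(2) G(2) 0(1)[of 0] by (metis le_refl)
next
  case (Suc D)
  define Q where "Q = P + smult (- coeff P (Suc D)) (b (Suc D))"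
  have B: "degree (b (Suc D)) = Suc D" "coeff (b (Suc D)) (Suc D) = 1"
      "F (b (Suc D)) = G (b (Suc D))"
    using Suc.prems(1)[of "Suc D"] by auto
  have "degree Q \<le> Suc D"
    unfolding Q_def by (rule degree_add_le) (use Suc.prems B in auto)
  moreover have "coeff Q (Suc D) = 0"
    using B by (simp add: Q_def)
  ultimately have "degree Q \<le> D"
    by (metis Suc_leI degree_0 le_neq_implies_less le_zero_eq leading_coeff_0_iff less_Suc_eq_le zero_le)
  then have "F Q = G Q"
    using Suc.prems(1) by (intro Suc.IH) auto
  moreover have "P = Q + smult (coeff P (Suc D)) (b (Suc D))"
    by (simp add: Q_def)
  ultimately show ?case
    using F G B by metis
qed


section \<open>Gaussian binomial inversion\<close>

text \<open>This is \<open>(b - 1) ^ n\<close> times the usual \<open>b\<close>-factorial; the extra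
  factors cancel in Gaussian binomials.\<close>

definition gauss_fact :: "real \<Rightarrow> nat \<Rightarrow> real" where
  "gauss_fact b n = (\<Prod>i<n. b ^ Suc i - 1)"

lemma gauss_fact_Suc: "gauss_fact b (Suc n) = (b ^ Suc n - 1) * gauss_fact b n"
  by (simp add: gauss_fact_def)

lemma gauss_fact_nonzero:
  assumes "b > 1"
  shows "gauss_fact b n \<noteq> 0"
proof -
  have "b ^ Suc i \<noteq> 1" for i
    using one_less_power[OF assms, of "Suc i"] by simp
  then show ?thesis by (simp add: gauss_fact_def)
qed

lemma gauss_binom_eq_0: "n < v \<Longrightarrow> gauss_binom b n v = 0"
  by (simp add: gauss_binom_def)

lemma gauss_fact_split:
  "v \<le> n \<Longrightarrow> gauss_fact b n = (\<Prod>i<v. b ^ (n - i) - 1) * gauss_fact b (n - v)"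
proof (induction v)
  case (Suc v)
  then have "n - v = Suc (n - Suc v)" by simp
  then have "gauss_fact b (n - v) = (b ^ (n - v) - 1) * gauss_fact b (n - Suc v)"
    by (simp only: gauss_fact_Suc)
  with Suc show ?case by simp
qed simp

lemma gauss_binom_fact:
  assumes "b > 1" "v \<le> n"
  shows "gauss_binom b n v = gauss_fact b n / (gauss_fact b v * gauss_fact b (n - v))"
  using assms gauss_fact_split[OF assms(2), of b] gauss_fact_nonzero[OF assms(1)]
  by (simp add: gauss_binom_def gauss_fact_def[of b v])

lemma gauss_binom_0 [simp]: "gauss_binom b n 0 = 1"
  by (simp add: gauss_binom_def)

lemma gauss_binom_Suc_Suc:
  assumes "b > 1"
  shows "gauss_binom b (Suc n) (Suc u) = b ^ Suc u * gauss_binom b n (Suc u) + gauss_binom b n u"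
proof -
  consider "n < u" | "n = u" | l where "n = Suc u + l"
    by (metis linorder_neqE_nat less_imp_Suc_add add_Suc)
  then show ?thesis
  proof cases
    case 1
    then show ?thesis by (simp add: gauss_binom_eq_0)
  next
    case 2
    then show ?thesis
      using gauss_fact_nonzero[OF assms] assms gauss_fact_def[of b 0]
      by (simp add: gauss_binom_fact gauss_binom_eq_0 del: power_Suc)
  next
    case (3 l)
    have nz: "gauss_fact b i \<noteq> 0" for i
      by (rule gauss_fact_nonzero[OF assms])
    have nz': "b ^ Suc i - 1 \<noteq> 0" for i
      using nz[of "Suc i"] by (simp add: gauss_fact_Suc)
    \<comment> \<open>All three binomials are multiples of \<open>?c\<close>, so the Pascal rule
      reduces to \<open>x * y - 1 = x * (y - 1) + (x - 1)\<close> with \<open>x = b ^ Suc u\<close>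
      and \<open>y = b ^ Suc l\<close>.\<close>
    let ?c = "gauss_fact b n / (gauss_fact b (Suc u) * gauss_fact b (Suc l))"
    have "gauss_binom b (Suc n) (Suc u) = (b ^ Suc n - 1) * ?c"
      using 3 assms by (simp add: gauss_binom_fact gauss_fact_Suc)
    moreover have "gauss_binom b n (Suc u) = (b ^ Suc l - 1) * ?c"
      using 3 assms nz nz' by (simp add: gauss_binom_fact gauss_fact_Suc[of b l] del: power_Suc)
    moreover have "gauss_binom b n u = (b ^ Suc u - 1) * ?c"
      using 3 assms nz nz' by (simp add: gauss_binom_fact gauss_fact_Suc[of b u] del: power_Suc)
    moreover have "b ^ Suc n = b ^ Suc u * b ^ Suc l"
      using 3 by (simp add: power_add)
    moreover have "(x * y - 1) * c = x * ((y - 1) * c) + (x - 1) * c" for x y c :: real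
      by (simp add: algebra_simps)
    ultimately show ?thesis by metis
  qed
qed

text \<open>The sum telescopes: the Pascal rule splits each new term into one part cancelling the
  previous partial sum and one part that is the next closed form.\<close>

lemma gauss_alternating_partial_sum:
  assumes "b > 1"
  shows "(\<Sum>u\<le>t. (-1) ^ u * b ^ (u choose 2) * gauss_binom b (Suc n) u)
      = (-1) ^ t * b ^ (Suc t choose 2) * gauss_binom b n t"
proof (induction t)
  case (Suc t)
  have "Suc (Suc t) choose 2 = (Suc t choose 2) + Suc t"
    by (simp add: numeral_2_eq_2)
  then show ?case
    using Suc by (simp add: gauss_binom_Suc_Suc[OF assms] power_add algebra_simps)
qed (simp add: binomial_eq_0)

lemma gauss_alternating_sum:
  assumes "b > 1"
  shows "(\<Sum>u\<le>n. (-1) ^ u * b ^ (u choose 2) * gauss_binom b n u) = (if n = 0 then 1 else 0)"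
  using gauss_alternating_partial_sum[OF assms, of "n - 1" n]
  by (cases n) (simp_all add: gauss_alternating_partial_sum[OF assms] gauss_binom_eq_0 binomial_eq_0 del: sum.atMost_Suc)

text \<open>The product of the binomials \<open>v\<close> over \<open>j\<close> and \<open>i\<close>
  over \<open>v\<close> equals that of \<open>i\<close> over \<open>j\<close> and
  \<open>i - j\<close> over \<open>v - j\<close>. The first factor leaves the sum, and the
  alternating sum of row \<open>i - j\<close> remains.\<close>

lemma gauss_orthogonality:
  assumes "b > 1" and that: "i \<le> D" "j \<le> D"
  shows "(\<Sum>v=j..D. (-1) ^ (v - j) * b ^ ((v - j) choose 2) * gauss_binom b v j * gauss_binom b i v)
      = (if i = j then 1 else 0)"
proof (cases "j \<le> i")
  case True
  have nz: "gauss_fact b l \<noteq> 0" for l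
    by (rule gauss_fact_nonzero[OF assms(1)])
  let ?f = "\<lambda>v. (-1) ^ (v - j) * b ^ ((v - j) choose 2) * gauss_binom b v j * gauss_binom b i v"
  have "(\<Sum>v=j..D. ?f v) = (\<Sum>v=j..i. ?f v)"
    by (rule sum.mono_neutral_right) (use that gauss_binom_eq_0 in auto)
  also have "\<dots> = (\<Sum>u\<le>i - j. ?f (u + j))"
    using sum.shift_bounds_cl_nat_ivl[of ?f 0 j "i - j"] True by (simp add: atMost_atLeast0)
  also have "\<dots> = (\<Sum>u\<le>i - j. gauss_binom b i j *
      ((-1) ^ u * b ^ (u choose 2) * gauss_binom b (i - j) u))"
  proof (rule sum.cong)
    fix u assume "u \<in> {..i - j}"
    then have u: "u + j \<le> i" "u \<le> i - j" using True by auto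
    then have "gauss_binom b (u + j) j * gauss_binom b i (u + j)
        = gauss_binom b i j * gauss_binom b (i - j) u"
      using True nz by (simp add: gauss_binom_fact[OF assms(1)] add.commute)
    then show "?f (u + j) = gauss_binom b i j *
        ((-1) ^ u * b ^ (u choose 2) * gauss_binom b (i - j) u)"
      by simp
  qed simp
  also have "\<dots> = gauss_binom b i j * (if i - j = 0 then 1 else 0)"
    by (simp only: sum_distrib_left[symmetric] gauss_alternating_sum[OF assms(1)])
  also have "\<dots> = (if i = j then 1 else 0)"
    using True nz gauss_fact_def[of b 0] by (simp add: gauss_binom_fact[OF assms(1)])
  finally show ?thesis .
next
  case False
  then show ?thesis by (auto intro!: sum.neutral simp: gauss_binom_eq_0)
qed

lemma gauss_inversion:
  assumes "b > 1" "j \<le> D"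
    and \<gamma>: "\<And>v. v \<le> D \<Longrightarrow> (\<Sum>i\<le>D. \<alpha> i * gauss_binom b i v) = \<gamma> v"
  shows "\<alpha> j = (\<Sum>v=j..D. (-1) ^ (v - j) * b ^ ((v - j) choose 2) * gauss_binom b v j * \<gamma> v)"
proof -
  let ?f = "\<lambda>v. (-1) ^ (v - j) * b ^ ((v - j) choose 2) * gauss_binom b v j"
  have "(\<Sum>v=j..D. ?f v * \<gamma> v) = (\<Sum>v=j..D. \<Sum>i\<le>D. \<alpha> i * (?f v * gauss_binom b i v))"
    by (intro sum.cong) (auto simp: \<gamma>[symmetric] sum_distrib_left mult_ac)
  also have "\<dots> = (\<Sum>i\<le>D. \<alpha> i * (\<Sum>v=j..D. ?f v * gauss_binom b i v))"
    by (subst sum.swap) (simp add: sum_distrib_left)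
  also have "\<dots> = (\<Sum>i\<le>D. \<alpha> i * (if i = j then 1 else 0))"
    by (intro sum.cong) (use assms gauss_orthogonality in auto)
  also have "\<dots> = \<alpha> j"
    using assms(2) by (simp add: if_distrib cong: if_cong)
  finally show ?thesis by simp
qed

text \<open>With \<open>b = q ^ 2\<close>, this turns the even-root polynomial at a radical size
  into a binomial moment. For \<open>n < v\<close> the factor at \<open>i = n\<close> vanishes,
  matching the zero binomial.\<close>

lemma prod_power_diff_gauss_binom:
  assumes "b > 1"
  shows "(\<Prod>i<v. b ^ n - b ^ i) = (\<Prod>i<v. b ^ i) * gauss_fact b v * gauss_binom b n v"
proof (cases "v \<le> n")
  case True
  have "(\<Prod>i<v. b ^ n - b ^ i) = (\<Prod>i<v. b ^ i * (b ^ (n - i) - 1))"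
    using True by (intro prod.cong) (auto simp: right_diff_distrib power_add[symmetric])
  then show ?thesis
    using True gauss_fact_nonzero[OF assms, of v]
    by (simp add: prod.distrib gauss_binom_def gauss_fact_def)
next
  case False
  then have "(\<Prod>i<v. b ^ n - b ^ i) = 0" by (intro prod_zero) auto
  with False show ?thesis by (simp add: gauss_binom_eq_0)
qed

section \<open>Counting in finite abelian groups\<close>

lemma card_image_kernel:
  fixes f :: "'b::ab_group_add \<Rightarrow> 'c::ab_group_add"
  assumes "finite G"
    and diff: "\<And>x y. x \<in> G \<Longrightarrow> y \<in> G \<Longrightarrow> x - y \<in> G"
    and add: "\<And>x y. f (x + y) = f x + f y"
  shows "card G = card (f ` G) * card {x \<in> G. f x = 0}"
proof -
  have f_diff: "f (x - y) = f x - f y" for x y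
    using add[of "x - y" y] by simp
  \<comment> \<open>A sum is the difference \<open>x - ((y - y) - y)\<close>, so closure under
    differences is enough.\<close>
  have plus: "x + y \<in> G" if "x \<in> G" "y \<in> G" for x y
    using diff[OF that(1) diff[OF diff[OF that(2) that(2)] that(2)]] by simp
  have fiber: "card {x \<in> G. f x = c} = card {x \<in> G. f x = 0}" if "c \<in> f ` G" for c
  proof -
    obtain g where g: "g \<in> G" "f g = c" using \<open>c \<in> f ` G\<close> by auto
    have "bij_betw (\<lambda>x. x - g) {x \<in> G. f x = c} {x \<in> G. f x = 0}"
      by (rule bij_betw_byWitness[where f' = "\<lambda>x. x + g"])
         (use g diff plus add f_diff in auto)
    then show ?thesis by (rule bij_betw_same_card)
  qed
  have "card G = (\<Sum>c\<in>f ` G. card {x \<in> G. f x = c})"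
    using sum.image_gen[OF \<open>finite G\<close>, of "\<lambda>_. 1::nat" f] by simp
  then show ?thesis by (simp add: fiber)
qed

text \<open>Count the pairs with \<open>\<beta> g h = 0\<close> by rows and by columns. A row
  contributes \<open>card H\<close> if it is identically zero and \<open>card H / q\<close>
  otherwise, and likewise for columns; equating the two counts leaves a common factor
  \<open>q - 1\<close> to cancel.\<close>

lemma card_annihilators:
  fixes \<beta> :: "'b \<Rightarrow> 'c \<Rightarrow> 'd::zero"
  assumes fin: "finite G" "finite H" and "1 < q"
    and left: "\<And>g. g \<in> G \<Longrightarrow> \<exists>h\<in>H. \<beta> g h \<noteq> 0 \<Longrightarrow> card {h \<in> H. \<beta> g h = 0} * q = card H"
    and right: "\<And>h. h \<in> H \<Longrightarrow> \<exists>g\<in>G. \<beta> g h \<noteq> 0 \<Longrightarrow> card {g \<in> G. \<beta> g h = 0} * q = card G"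
  shows "card {g \<in> G. \<forall>h\<in>H. \<beta> g h = 0} * card H = card {h \<in> H. \<forall>g\<in>G. \<beta> g h = 0} * card G"
proof -
  have count: "(\<Sum>x\<in>A. card {y \<in> B. R x y}) * q
      = card {x \<in> A. \<forall>y\<in>B. R x y} * card B * (q - 1) + card A * card B"
    if "finite A" and *: "\<And>x. x \<in> A \<Longrightarrow> \<exists>y\<in>B. \<not> R x y \<Longrightarrow> card {y \<in> B. R x y} * q = card B"
    for A :: "'x set" and B :: "'y set" and R
  proof -
    have "(\<Sum>x\<in>A. card {y \<in> B. R x y}) * q
        = (\<Sum>x\<in>A. (if \<forall>y\<in>B. R x y then card B * (q - 1) else 0) + card B)"
      unfolding sum_distrib_right
    proof (rule sum.cong)
      fix x assume "x \<in> A"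
      show "card {y \<in> B. R x y} * q = (if \<forall>y\<in>B. R x y then card B * (q - 1) else 0) + card B"
      proof (cases "\<forall>y\<in>B. R x y")
        case True
        then have "{y \<in> B. R x y} = B" by auto
        then show ?thesis using True \<open>1 < q\<close> by (cases q) auto
      qed (use *[OF \<open>x \<in> A\<close>] in auto)
    qed simp
    also have "\<dots> = card {x \<in> A. \<forall>y\<in>B. R x y} * card B * (q - 1) + card A * card B"
      using \<open>finite A\<close> by (simp add: sum.distrib sum.If_cases Int_def mult.assoc)
    finally show ?thesis .
  qed
  have "(\<Sum>g\<in>G. card {h \<in> H. \<beta> g h = 0}) = (\<Sum>h\<in>H. card {g \<in> G. \<beta> g h = 0})"
  proof -
    have "(\<Sum>g\<in>G. card {h \<in> H. \<beta> g h = 0}) = (\<Sum>g\<in>G. \<Sum>h\<in>H. if \<beta> g h = 0 then 1 else 0)"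
      using fin by (simp add: sum.If_cases Int_def)
    also have "\<dots> = (\<Sum>h\<in>H. \<Sum>g\<in>G. if \<beta> g h = 0 then 1 else 0)"
      by (rule sum.swap)
    also have "\<dots> = (\<Sum>h\<in>H. card {g \<in> G. \<beta> g h = 0})"
      using fin by (simp add: sum.If_cases Int_def)
    finally show ?thesis .
  qed
  moreover have "(\<Sum>g\<in>G. card {h \<in> H. \<beta> g h = 0}) * q
      = card {g \<in> G. \<forall>h\<in>H. \<beta> g h = 0} * card H * (q - 1) + card G * card H"
    by (rule count) (use fin left in auto)
  moreover have "(\<Sum>h\<in>H. card {g \<in> G. \<beta> g h = 0}) * q
      = card {h \<in> H. \<forall>g\<in>G. \<beta> g h = 0} * card G * (q - 1) + card H * card G"
    by (rule count) (use fin right in auto)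
  ultimately have "card {g \<in> G. \<forall>h\<in>H. \<beta> g h = 0} * card H * (q - 1)
      = card {h \<in> H. \<forall>g\<in>G. \<beta> g h = 0} * card G * (q - 1)"
    by (simp only: mult.commute[of "card H" "card G"])
  then show ?thesis using \<open>1 < q\<close> by simp
qed

section \<open>Skew polynomials over cyclic extensions of finite fields\<close>

lemma sum_periodic_shift:
  fixes F :: "nat \<Rightarrow> 'b::ab_group_add"
  assumes "\<And>s. F (s + N) = F s"
  shows "(\<Sum>u<N. F (t + u)) = (\<Sum>u<N. F u)"
proof (induction t)
  case (Suc t)
  have "(\<Sum>u<N. F (Suc t + u)) = (\<Sum>u<Suc N. F (t + u)) - F t"
    by (simp only: sum.lessThan_Suc_shift) simp
  also have "\<dots> = (\<Sum>u<N. F (t + u))"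
    using assms[of t] by simp
  finally show ?case using Suc by simp
qed simp

text \<open>When the coefficients sum to 0 the boundary term drops out and only differences
  \<open>s (Suc i) - s i\<close> remain; this is right division by
  \<open>\<sigma> - 1\<close>.\<close>

lemma abel_summation:
  fixes c s :: "nat \<Rightarrow> 'b::comm_ring"
  shows "(\<Sum>i\<le>Suc D. c i * s i)
    = (\<Sum>l\<le>Suc D. c l) * s (Suc D) - (\<Sum>i\<le>D. (\<Sum>l\<le>i. c l) * (s (Suc i) - s i))"
  by (induction D) (simp_all add: algebra_simps)

text \<open>Abstracting from a particular Frobenius power allows two instances on the same field:
  one for the skew polynomials and one for the traces.\<close>

locale cyclic_ext =
  fixes \<sigma> :: "'a::{field,finite} \<Rightarrow> 'a" and q N :: nat
  assumes \<sigma>_add: "\<sigma> (x + y) = \<sigma> x + \<sigma> y"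
    and \<sigma>_mult: "\<sigma> (x * y) = \<sigma> x * \<sigma> y"
    and \<sigma>_1: "\<sigma> 1 = 1"
    and \<sigma>_period: "(\<sigma> ^^ N) x = x"
    and card_fixed: "card {x. \<sigma> x = x} = q"
    and card_field: "card (UNIV :: 'a set) = q ^ N"
    and q_gt_1: "1 < q"
    and N_pos: "0 < N"
    and char_2: "(1 :: 'a) + 1 = 0"
begin

section \<open>Characteristic 2, iterates of the automorphism, and its fixed field\<close>

lemma self_add [simp]: "x + x = (0 :: 'a)"
  using char_2 distrib_left[of x 1 1] by simp

lemma two_eq_0 [simp]: "(2 :: 'a) = 0"
  using char_2 by (simp only: one_add_one)

lemma minus_eq [simp]: "- x = (x :: 'a)"
  by (rule minus_unique) simp

lemma diff_eq [simp]: "x - y = x + (y :: 'a)"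
  by (metis minus_eq diff_conv_add_uminus)

lemma add_eq_0_iff' : "x + y = 0 \<longleftrightarrow> x = (y :: 'a)"
  by (metis minus_eq eq_neg_iff_add_eq_0)

lemma \<sigma>_0 [simp]: "\<sigma> 0 = 0"
  using \<sigma>_add[of 0 0] by simp

lemma iter_add: "(\<sigma> ^^ s) (x + y) = (\<sigma> ^^ s) x + (\<sigma> ^^ s) y"
  by (induction s) (simp_all add: \<sigma>_add)

lemma iter_mult: "(\<sigma> ^^ s) (x * y) = (\<sigma> ^^ s) x * (\<sigma> ^^ s) y"
  by (induction s) (simp_all add: \<sigma>_mult)

lemma iter_0 [simp]: "(\<sigma> ^^ s) 0 = 0"
  by (induction s) simp_all

lemma iter_sum: "(\<sigma> ^^ s) (sum f A) = (\<Sum>i\<in>A. (\<sigma> ^^ s) (f i))"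
  by (induction A rule: infinite_finite_induct) (simp_all add: iter_add)

lemma iter_period [simp]: "(\<sigma> ^^ (s + N)) x = (\<sigma> ^^ s) x"
  by (simp add: funpow_add \<sigma>_period)

lemma \<sigma>_eq_0_iff: "\<sigma> x = 0 \<longleftrightarrow> x = 0"
proof
  assume "\<sigma> x = 0"
  moreover have "(\<sigma> ^^ N) x = (\<sigma> ^^ (N - 1)) (\<sigma> x)"
    using N_pos by (cases N) (simp_all add: funpow_swap1)
  ultimately show "x = 0" using \<sigma>_period[of x] by simp
qed simp

lemma iter_eq_0_iff: "(\<sigma> ^^ s) x = 0 \<longleftrightarrow> x = 0"
  by (induction s) (simp_all add: \<sigma>_eq_0_iff)

lemma inj_iter: "inj (\<sigma> ^^ s)"
proof (rule injI)
  fix x y assume "(\<sigma> ^^ s) x = (\<sigma> ^^ s) y"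
  then have "(\<sigma> ^^ s) (x + y) = 0" by (simp add: iter_add)
  then show "x = y" by (simp add: iter_eq_0_iff add_eq_0_iff')
qed

definition K :: "'a set" where "K = {x. \<sigma> x = x}"

lemma K_0 [simp]: "0 \<in> K" and K_1 [simp]: "1 \<in> K"
  and K_add: "a \<in> K \<Longrightarrow> b \<in> K \<Longrightarrow> a + b \<in> K"
  and K_mult: "a \<in> K \<Longrightarrow> b \<in> K \<Longrightarrow> a * b \<in> K"
  by (simp_all add: K_def \<sigma>_1 \<sigma>_add \<sigma>_mult)

lemma K_inverse: "a \<in> K \<Longrightarrow> inverse a \<in> K"
proof (cases "a = 0")
  case False
  assume "a \<in> K"
  then have "\<sigma> (inverse a) * a = 1"
    using False \<sigma>_mult[of "inverse a" a] by (simp add: K_def \<sigma>_1)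
  then have "\<sigma> (inverse a) = inverse a"
    using False by (simp add: field_simps)
  then show ?thesis by (simp add: K_def)
qed simp

lemma K_divide: "a \<in> K \<Longrightarrow> b \<in> K \<Longrightarrow> a / b \<in> K"
  by (simp add: divide_inverse K_mult K_inverse)

lemma K_sum: "(\<And>i. i \<in> A \<Longrightarrow> f i \<in> K) \<Longrightarrow> sum f A \<in> K"
  by (induction A rule: infinite_finite_induct) (simp_all add: K_add)

lemma iter_K: "c \<in> K \<Longrightarrow> (\<sigma> ^^ s) c = c"
  by (induction s) (simp_all add: K_def)

lemma card_K: "card K = q"
  by (simp add: K_def card_fixed)

text \<open>After scaling a nonzero root to 1 the coefficients sum to 0, so the skew polynomial factors
  on the right through \<open>\<sigma> - 1\<close>, whose kernel has \<open>q\<close> elements.\<close>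

lemma card_skew_kernel:
  assumes "\<exists>i\<le>D. c i \<noteq> 0"
  shows "card {x. (\<Sum>i\<le>D. c i * (\<sigma> ^^ i) x) = 0} \<le> q ^ D"
  using assms
proof (induction D arbitrary: c)
  case 0
  then have "{x. (\<Sum>i\<le>0. c i * (\<sigma> ^^ i) x) = 0} = {0}" by auto
  then show ?case by simp
next
  case (Suc D)
  let ?S = "{x. (\<Sum>i\<le>Suc D. c i * (\<sigma> ^^ i) x) = 0}"
  show ?case
  proof (cases "?S \<subseteq> {0}")
    case True
    then have "card ?S \<le> 1"
      using card_mono[OF _ True] by simp
    then show ?thesis
      using q_gt_1 one_le_power[of q "Suc D"] by linarith
  next
    case False
    then obtain w where w: "w \<noteq> 0" "(\<Sum>i\<le>Suc D. c i * (\<sigma> ^^ i) w) = 0" by blast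
    define c' where "c' = (\<lambda>i. c i * (\<sigma> ^^ i) w)"
    define C where "C = (\<lambda>i. \<Sum>l\<le>i. c' l)"
    let ?T = "{u. (\<Sum>i\<le>Suc D. c' i * (\<sigma> ^^ i) u) = 0}"
    let ?\<tau> = "\<lambda>u. \<sigma> u - u"
    have "bij_betw (\<lambda>u. w * u) ?T ?S"
      by (rule bij_betw_byWitness[where f' = "\<lambda>x. x / w"])
         (use w in \<open>auto simp: c'_def iter_mult[symmetric] mult.assoc simp del: sum.atMost_Suc\<close>)
    then have card_eq: "card ?S = card ?T"
      by (simp only: bij_betw_same_card)
    have C_last: "C (Suc D) = 0" using w by (simp only: C_def c'_def)
    have c'_nz: "\<exists>i\<le>Suc D. c' i \<noteq> 0"
      using Suc.prems w by (auto simp: c'_def iter_eq_0_iff)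
    have C_nz: "\<exists>i\<le>D. C i \<noteq> 0"
    proof (rule ccontr)
      assume "\<not> ?thesis"
      then have z: "C i = 0" if "i \<le> Suc D" for i
        using that C_last le_SucE by blast
      have "c' i = 0" if "i \<le> Suc D" for i
      proof (cases i)
        case 0
        then show ?thesis using z[of 0] by (simp add: C_def)
      next
        case (Suc l)
        then have "C i = C l + c' i" by (simp add: C_def)
        then show ?thesis using z[of i] z[of l] that Suc by simp
      qed
      with c'_nz show False by blast
    qed
    have factor: "(\<Sum>i\<le>Suc D. c' i * (\<sigma> ^^ i) u) = (\<Sum>i\<le>D. C i * (\<sigma> ^^ i) (?\<tau> u))" for u
    proof -
      have "(\<Sum>i\<le>Suc D. c' i * (\<sigma> ^^ i) u)
          = C (Suc D) * (\<sigma> ^^ Suc D) u - (\<Sum>i\<le>D. C i * ((\<sigma> ^^ Suc i) u - (\<sigma> ^^ i) u))"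
        unfolding C_def by (rule abel_summation)
      then show ?thesis
        by (simp add: C_last iter_add funpow_swap1)
    qed
    have "card ?T = card (?\<tau> ` ?T) * card {u \<in> ?T. ?\<tau> u = 0}"
    proof (rule card_image_kernel)
      show "x - y \<in> ?T" if "x \<in> ?T" "y \<in> ?T" for x y
        using that by (simp add: iter_add distrib_left sum.distrib algebra_simps add_eq_0_iff'
            del: sum.atMost_Suc)
    qed (simp_all add: \<sigma>_add)
    also have "\<dots> \<le> q ^ D * q"
    proof (rule mult_le_mono)
      have "?\<tau> ` ?T \<subseteq> {x. (\<Sum>i\<le>D. C i * (\<sigma> ^^ i) x) = 0}"
        by (auto simp only: factor mem_Collect_eq)
      then have "card (?\<tau> ` ?T) \<le> card {x. (\<Sum>i\<le>D. C i * (\<sigma> ^^ i) x) = 0}"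
        by (intro card_mono) auto
      also have "\<dots> \<le> q ^ D" by (rule Suc.IH[OF C_nz])
      finally show "card (?\<tau> ` ?T) \<le> q ^ D" .
      show "card {u \<in> ?T. ?\<tau> u = 0} \<le> q"
        unfolding card_fixed[symmetric] by (intro card_mono) (auto simp: add_eq_0_iff')
    qed
    finally show ?thesis by (simp only: card_eq power_Suc2)
  qed
qed

section \<open>The trace form\<close>

definition tr :: "'a \<Rightarrow> 'a" where "tr z = (\<Sum>s<N. (\<sigma> ^^ s) z)"

lemma tr_add: "tr (x + y) = tr x + tr y"
  by (simp add: tr_def iter_add sum.distrib)

lemma tr_0 [simp]: "tr 0 = 0"
  by (simp add: tr_def)

lemma tr_sum: "tr (sum f A) = (\<Sum>i\<in>A. tr (f i))"
  by (induction A rule: infinite_finite_induct) (simp_all add: tr_add)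

lemma tr_scale: "c \<in> K \<Longrightarrow> tr (c * x) = c * tr x"
  by (simp add: tr_def iter_mult iter_K sum_distrib_left)

lemma tr_in_K: "tr z \<in> K"
proof -
  have "\<sigma> (tr z) = (\<Sum>s<N. (\<sigma> ^^ (1 + s)) z)"
    using iter_sum[of 1 "\<lambda>s. (\<sigma> ^^ s) z" "{..<N}"] by (simp add: tr_def)
  also have "\<dots> = tr z"
    unfolding tr_def by (rule sum_periodic_shift) (rule iter_period)
  finally show ?thesis by (simp add: K_def)
qed

text \<open>Linear independence of the powers of \<open>\<sigma>\<close>: a nonzero skew polynomial
  of degree at most \<open>N - 1\<close> has at most \<open>q ^ (N - 1)\<close> zeros, fewer than
  the field has elements.\<close>

lemma skew_zero_imp_coeffs_zero:
  assumes "\<And>z. (\<Sum>s<N. c s * (\<sigma> ^^ s) z) = 0" "s < N"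
  shows "c s = 0"
proof (rule ccontr)
  assume "c s \<noteq> 0"
  then have "card {z. (\<Sum>i\<le>N - 1. c i * (\<sigma> ^^ i) z) = 0} \<le> q ^ (N - 1)"
    using \<open>s < N\<close> by (intro card_skew_kernel exI[of _ s]) auto
  moreover have "{..N - 1} = {..<N}" using N_pos by auto
  ultimately have "q ^ N \<le> q ^ (N - 1)"
    using assms(1) by (simp add: card_field)
  then show False
    using q_gt_1 N_pos by (simp add: power_increasing_iff)
qed

text \<open>As a function of \<open>y\<close>, \<open>tr (x * y)\<close> is a skew polynomial whose
  coefficient at \<open>s = 0\<close> is \<open>x\<close>.\<close>

lemma tr_nondegenerate:
  assumes "\<And>y. tr (x * y) = 0"
  shows "x = 0"
proof -
  have "(\<Sum>s<N. (\<sigma> ^^ s) x * (\<sigma> ^^ s) z) = 0" for z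
    using assms[of z] by (simp add: tr_def iter_mult)
  from skew_zero_imp_coeffs_zero[OF this N_pos] show ?thesis by simp
qed

text \<open>A nonzero functional closed under scaling is onto \<open>K\<close>, so its kernel has
  index \<open>q\<close>. Scaling is phrased as existence of a preimage so that field elements and
  coefficient tuples are both covered.\<close>

lemma card_functional_kernel:
  fixes f :: "'b::ab_group_add \<Rightarrow> 'a"
  assumes "finite G"
    and diff: "\<And>x y. x \<in> G \<Longrightarrow> y \<in> G \<Longrightarrow> x - y \<in> G"
    and add: "\<And>x y. f (x + y) = f x + f y"
    and "\<And>x. x \<in> G \<Longrightarrow> f x \<in> K"
    and scale: "\<And>x c. x \<in> G \<Longrightarrow> c \<in> K \<Longrightarrow> \<exists>x'\<in>G. f x' = c * f x"
    and nz: "\<exists>x\<in>G. f x \<noteq> 0"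
  shows "card {x \<in> G. f x = 0} * q = card G"
proof -
  obtain x where x: "x \<in> G" "f x \<noteq> 0" using nz by blast
  have "K \<subseteq> f ` G"
  proof
    fix c assume "c \<in> K"
    then have "c / f x \<in> K" using assms(4)[OF x(1)] by (rule K_divide)
    then obtain x' where "x' \<in> G" "f x' = c / f x * f x" using scale x by blast
    then show "c \<in> f ` G" using x by force
  qed
  then have "f ` G = K" using assms(4) by auto
  then show ?thesis
    using card_image_kernel[of G f, OF assms(1) diff add] card_K by simp
qed

section \<open>Subspaces, spans and independent tuples\<close>

definition subsp :: "'a set \<Rightarrow> bool" where
  "subsp R \<longleftrightarrow> 0 \<in> R \<and> (\<forall>x\<in>R. \<forall>y\<in>R. x + y \<in> R) \<and> (\<forall>c\<in>K. \<forall>x\<in>R. c * x \<in> R)"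

lemma subsp_UNIV: "subsp UNIV" by (simp add: subsp_def)

lemma subsp_sum: "subsp R \<Longrightarrow> (\<And>i. i \<in> A \<Longrightarrow> f i \<in> R) \<Longrightarrow> sum f A \<in> R"
  by (induction A rule: infinite_finite_induct) (simp_all add: subsp_def)

text \<open>Adding one generator at a time exhibits each span as an image of
  \<open>spn x v \<times> K\<close>, injective exactly when the new generator is independent; this
  gives the cardinality.\<close>

primrec spn :: "(nat \<Rightarrow> 'a) \<Rightarrow> nat \<Rightarrow> 'a set" where
  "spn x 0 = {0}"
| "spn x (Suc v) = (\<lambda>(w, s). w + s * x v) ` (spn x v \<times> K)"

lemma subsp_spn: "subsp (spn x v)"
proof (induction v)
  case (Suc v)
  show ?case
    unfolding subsp_def
  proof (intro conjI ballI)
    show "0 \<in> spn x (Suc v)"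
      using Suc by (auto simp: subsp_def intro!: image_eqI[of _ _ "(0, 0)"])
  next
    fix a b assume "a \<in> spn x (Suc v)" "b \<in> spn x (Suc v)"
    then obtain w s w' s' where *: "a = w + s * x v" "b = w' + s' * x v"
      "w \<in> spn x v" "w' \<in> spn x v" "s \<in> K" "s' \<in> K" by auto
    then have "(w + w', s + s') \<in> spn x v \<times> K" using Suc by (simp add: subsp_def K_add)
    moreover have "a + b = (\<lambda>(w, s). w + s * x v) (w + w', s + s')"
      using * by (simp add: algebra_simps)
    ultimately show "a + b \<in> spn x (Suc v)" by (simp only: spn.simps image_eqI)
  next
    fix c a assume "c \<in> K" "a \<in> spn x (Suc v)"
    then obtain w s where *: "a = w + s * x v" "w \<in> spn x v" "s \<in> K" by auto
    then have "(c * w, c * s) \<in> spn x v \<times> K" using Suc \<open>c \<in> K\<close> by (simp add: subsp_def K_mult)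
    moreover have "c * a = (\<lambda>(w, s). w + s * x v) (c * w, c * s)"
      using * by (simp add: algebra_simps)
    ultimately show "c * a \<in> spn x (Suc v)" by (simp only: spn.simps image_eqI)
  qed
qed (simp add: subsp_def)

lemma spn_mono_Suc: "spn x v \<subseteq> spn x (Suc v)"
  by (auto intro!: image_eqI[of _ _ "(_, 0)"])

lemma spn_mono: "v \<le> v' \<Longrightarrow> spn x v \<subseteq> spn x v'"
  using spn_mono_Suc by (rule lift_Suc_mono_le)

lemma spn_generator: "i < v \<Longrightarrow> x i \<in> spn x v"
proof -
  assume "i < v"
  have "x i \<in> spn x (Suc i)"
    using subsp_spn[of x i] by (auto simp: subsp_def intro!: image_eqI[of _ _ "(0, 1)"])
  then show ?thesis using spn_mono[of "Suc i" v x] \<open>i < v\<close> by auto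
qed

lemma spn_subset: "subsp R \<Longrightarrow> (\<And>i. i < v \<Longrightarrow> x i \<in> R) \<Longrightarrow> spn x v \<subseteq> R"
  by (induction v) (auto simp: subsp_def)

lemma spn_cong: "(\<And>i. i < v \<Longrightarrow> x i = x' i) \<Longrightarrow> spn x v = spn x' v"
  by (induction v) auto

definition indep :: "(nat \<Rightarrow> 'a) \<Rightarrow> nat \<Rightarrow> bool" where
  "indep x v \<longleftrightarrow> (\<forall>i<v. x i \<notin> spn x i)"

lemma indep_Suc: "indep x (Suc v) \<longleftrightarrow> indep x v \<and> x v \<notin> spn x v"
  by (auto simp: indep_def less_Suc_eq)

lemma card_spn: "indep x v \<Longrightarrow> card (spn x v) = q ^ v"
proof (induction v)
  case (Suc v)
  have "inj_on (\<lambda>(w, s). w + s * x v) (spn x v \<times> K)"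
  proof (rule inj_onI, clarify)
    fix w s w' s' assume *: "w \<in> spn x v" "w' \<in> spn x v" "s \<in> K" "s' \<in> K"
      "w + s * x v = w' + s' * x v"
    have eq: "(s - s') * x v = w - w'"
    proof -
      have "(w + s * x v) + (w' + s' * x v) = 0" using *(5) by simp
      then have "(s + s') * x v + (w + w') = 0" by (simp only: distrib_right add_ac)
      then show ?thesis by (simp add: add_eq_0_iff')
    qed
    have "s = s'"
    proof (rule ccontr)
      assume "s \<noteq> s'"
      then have "x v = inverse (s - s') * (w - w')"
        unfolding eq[symmetric] by (simp add: add_eq_0_iff')
      also have "\<dots> \<in> spn x v"
        using * subsp_spn[of x v] K_inverse[of "s - s'"] by (simp add: subsp_def K_add)
      finally show False using Suc.prems by (simp add: indep_Suc)
    qed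
    then show "w = w' \<and> s = s'" using * by simp
  qed
  then have "card (spn x (Suc v)) = card (spn x v \<times> K)"
    by (simp only: spn.simps card_image)
  then show ?case
    using Suc by (simp add: indep_Suc card_K)
qed simp

text \<open>Entries from \<open>v\<close> on are set to 0 so that each tuple is a single function
  and the set is finite.\<close>

definition indep_tuples :: "'a set \<Rightarrow> nat \<Rightarrow> (nat \<Rightarrow> 'a) set" where
  "indep_tuples R v = {x. (\<forall>i<v. x i \<in> R) \<and> (\<forall>i\<ge>v. x i = 0) \<and> indep x v}"

lemma finite_supported: "finite {x :: nat \<Rightarrow> 'a. \<forall>i\<ge>v. x i = 0}"
  and card_supported: "card {x :: nat \<Rightarrow> 'a. \<forall>i\<ge>v. x i = 0} = card (UNIV :: 'a set) ^ v"
proof -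
  let ?T = "\<lambda>v. {x :: nat \<Rightarrow> 'a. \<forall>i\<ge>v. x i = 0}"
  have "finite (?T v) \<and> card (?T v) = card (UNIV :: 'a set) ^ v"
  proof (induction v)
    case 0
    have "?T 0 = {\<lambda>_. 0}" by auto
    then show ?case by (simp del: Collect_const)
  next
    case (Suc v)
    have bij: "bij_betw (\<lambda>(x, t). x(v := t)) (?T v \<times> UNIV) (?T (Suc v))"
      by (rule bij_betw_byWitness[where f' = "\<lambda>x. (x(v := 0), x v)"])
         (auto simp: Suc_le_eq le_neq_implies_less fun_eq_iff)
    have "finite (?T (Suc v))"
      using bij_betw_finite[OF bij] Suc by simp
    moreover have "card (?T (Suc v)) = card (UNIV :: 'a set) ^ Suc v"
      using Suc by (simp add: card_cartesian_product bij_betw_same_card[OF bij, symmetric] mult.commute)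
    ultimately show ?case ..
  qed
  then show "finite (?T v)" "card (?T v) = card (UNIV :: 'a set) ^ v" by auto
qed

lemma finite_indep_tuples: "finite (indep_tuples R v)"
  by (rule finite_subset[OF _ finite_supported[of v]]) (auto simp: indep_tuples_def)

text \<open>The next vector may be anything in \<open>R\<close> outside the \<open>q ^ v\<close>
  elements already spanned. Over the reals no subtraction is truncated, so the product is also
  correct, namely 0, once no independent tuple exists.\<close>

lemma card_indep_tuples:
  assumes "subsp R"
  shows "real (card (indep_tuples R v)) = (\<Prod>i<v. real (card R) - real q ^ i)"
proof (induction v)
  case 0
  have "indep_tuples R 0 = {\<lambda>_. 0}" by (auto simp: indep_tuples_def indep_def)
  then show ?case by simp
next
  case (Suc v)
  have "bij_betw (\<lambda>(x, t). x(v := t)) (Sigma (indep_tuples R v) (\<lambda>x. R - spn x v)) (indep_tuples R (Suc v))"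
  proof (rule bij_betw_byWitness[where f' = "\<lambda>x. (x(v := 0), x v)"])
    have sp: "spn (x(v := t)) i = spn x i" if "i \<le> v" for x t i
      using that by (intro spn_cong) auto
    then have ind: "indep (x(v := t)) v = indep x v" for x t
      by (auto simp: indep_def)
    show "(\<lambda>(x, t). x(v := t)) ` (Sigma (indep_tuples R v) (\<lambda>x. R - spn x v)) \<subseteq> indep_tuples R (Suc v)"
      by (auto simp: indep_tuples_def indep_Suc sp ind less_Suc_eq)
    show "(\<lambda>x. (x(v := 0), x v)) ` indep_tuples R (Suc v) \<subseteq> Sigma (indep_tuples R v) (\<lambda>x. R - spn x v)"
      by (auto simp: indep_tuples_def indep_Suc sp ind)
  qed (auto simp: indep_tuples_def fun_eq_iff)
  then have "card (indep_tuples R (Suc v)) = card (Sigma (indep_tuples R v) (\<lambda>x. R - spn x v))"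
    by (simp only: bij_betw_same_card)
  also have "\<dots> = (\<Sum>x\<in>indep_tuples R v. card (R - spn x v))"
    by (simp add: finite_indep_tuples)
  finally have "real (card (indep_tuples R (Suc v))) = (\<Sum>x\<in>indep_tuples R v. real (card (R - spn x v)))"
    by simp
  also have "\<dots> = (\<Sum>x\<in>indep_tuples R v. real (card R) - real q ^ v)"
  proof (rule sum.cong)
    fix x assume "x \<in> indep_tuples R v"
    then have "spn x v \<subseteq> R" "card (spn x v) = q ^ v"
      using spn_subset[OF assms] card_spn by (auto simp: indep_tuples_def)
    then show "real (card (R - spn x v)) = real (card R) - real q ^ v"
      using card_mono[of R "spn x v"] by (simp add: card_Diff_subset of_nat_diff)
  qed simp
  finally show ?case using Suc by simp
qed


section \<open>Bivectors as skew polynomials\<close>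

definition wedge_coeff :: "(nat \<Rightarrow> 'a) \<Rightarrow> (nat \<Rightarrow> 'a) \<Rightarrow> nat \<Rightarrow> nat \<Rightarrow> 'a" where
  "wedge_coeff x y v s = (\<Sum>i<v. x i * (\<sigma> ^^ s) (y i) + y i * (\<sigma> ^^ s) (x i))"

text \<open>The bivector \<open>\<Sum>i<v. x i \<and> y i\<close>, with \<open>\<and>\<close> read
  as exterior product, viewed as an endomorphism through the trace form; \<open>wedge_coeff\<close>
  gives its coefficients in the powers of \<open>\<sigma>\<close>.\<close>

definition wedge_map :: "(nat \<Rightarrow> 'a) \<Rightarrow> (nat \<Rightarrow> 'a) \<Rightarrow> nat \<Rightarrow> 'a \<Rightarrow> 'a" where
  "wedge_map x y v z = (\<Sum>i<v. x i * tr (y i * z) + y i * tr (x i * z))"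

lemma wedge_map_skew: "wedge_map x y v z = (\<Sum>s<N. wedge_coeff x y v s * (\<sigma> ^^ s) z)"
proof -
  have "wedge_map x y v z
      = (\<Sum>i<v. \<Sum>s<N. (x i * (\<sigma> ^^ s) (y i) + y i * (\<sigma> ^^ s) (x i)) * (\<sigma> ^^ s) z)"
    by (simp add: wedge_map_def tr_def iter_mult sum_distrib_left sum.distrib algebra_simps)
  then show ?thesis
    unfolding wedge_coeff_def sum_distrib_right by (subst sum.swap)
qed

lemma wedge_coeff_period: "wedge_coeff x y v (s + N) = wedge_coeff x y v s"
  by (simp add: wedge_coeff_def)

lemma wedge_coeff_mod: "wedge_coeff x y v s = wedge_coeff x y v (s mod N)"
proof -
  have "wedge_coeff x y v (r + N * t) = wedge_coeff x y v r" for r t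
    by (induction t) (simp_all add: wedge_coeff_period add.assoc[symmetric] add.commute[of N])
  from this[of "s mod N" "s div N"] show ?thesis by simp
qed

text \<open>Applying \<open>\<sigma> ^^ (N - s)\<close> to \<open>a * (\<sigma> ^^ s) b\<close>
  moves the twist from \<open>b\<close> to \<open>a\<close>, which exchanges the two symmetric
  summands. Hence half of the coefficients determine the rest.\<close>

lemma wedge_coeff_reflect:
  assumes "s \<le> N"
  shows "wedge_coeff x y v (N - s) = (\<sigma> ^^ (N - s)) (wedge_coeff x y v s)"
proof -
  have "(\<sigma> ^^ (N - s)) ((\<sigma> ^^ s) a) = a" for a
    using assms \<sigma>_period[of a] by (simp flip: funpow_add[THEN fun_cong, unfolded comp_apply])
  then show ?thesis
    by (simp add: wedge_coeff_def iter_sum iter_add iter_mult mult.commute add.commute)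
qed

lemma wedge_map_0_iff: "(\<forall>z. wedge_map x y v z = 0) \<longleftrightarrow> (\<forall>s. wedge_coeff x y v s = 0)"
proof
  assume "\<forall>z. wedge_map x y v z = 0"
  then have "wedge_coeff x y v s = 0" if "s < N" for s
    using skew_zero_imp_coeffs_zero[of "wedge_coeff x y v" s] that by (simp add: wedge_map_skew)
  then show "\<forall>s. wedge_coeff x y v s = 0"
    using wedge_coeff_mod N_pos by (metis mod_less_divisor)
qed (simp add: wedge_map_skew)

text \<open>Each further trace condition is a map into \<open>K\<close> and shrinks the solution
  space by a factor of at most \<open>q\<close>.\<close>

lemma card_common_kernel: "q ^ N \<le> card {z. \<forall>i<v. tr (f i * z) = 0} * q ^ v"
proof (induction v)
  case 0
  then show ?case by (simp add: card_field)
next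
  case (Suc v)
  let ?G = "{z. \<forall>i<v. tr (f i * z) = 0}"
  have "card ?G = card ((\<lambda>z. tr (f v * z)) ` ?G) * card {z \<in> ?G. tr (f v * z) = 0}"
    by (rule card_image_kernel) (auto simp: distrib_left tr_add)
  moreover have "card ((\<lambda>z. tr (f v * z)) ` ?G) \<le> q"
    unfolding card_K[symmetric] by (rule card_mono) (auto simp: tr_in_K)
  moreover have "{z \<in> ?G. tr (f v * z) = 0} = {z. \<forall>i<Suc v. tr (f i * z) = 0}"
    by (auto simp: less_Suc_eq)
  ultimately have "card ?G \<le> q * card {z. \<forall>i<Suc v. tr (f i * z) = 0}"
    by simp
  then have "card ?G * q ^ v \<le> q * card {z. \<forall>i<Suc v. tr (f i * z) = 0} * q ^ v"
    by (rule mult_right_mono) simp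
  with Suc have "q ^ N \<le> q * card {z. \<forall>i<Suc v. tr (f i * z) = 0} * q ^ v"
    by (rule order.trans)
  then show ?case by (simp only: power_Suc mult.assoc mult.left_commute)
qed

text \<open>A wedge of \<open>v\<close> pairs has rank at most \<open>2 v\<close>, whereas a nonzero skew polynomial supported on
  the window \<open>{t..t + D}\<close> has rank at least \<open>N - D\<close>.\<close>

lemma wedge_coeff_window:
  assumes zero: "\<And>s. t + D < s \<Longrightarrow> s < t + N \<Longrightarrow> wedge_coeff x y v s = 0"
    and "D + 2 * v < N"
  shows "wedge_coeff x y v s = 0"
proof -
  let ?c = "\<lambda>u. wedge_coeff x y v (t + u)"
  \<comment> \<open>The period is read starting at \<open>t\<close>, which moves the window to
    \<open>{0..D}\<close> at the price of the bijection \<open>\<sigma> ^^ t\<close>.\<close>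
  have map_eq: "wedge_map x y v z = (\<Sum>u\<le>D. ?c u * (\<sigma> ^^ u) ((\<sigma> ^^ t) z))" for z
  proof -
    have "wedge_map x y v z = (\<Sum>u<N. ?c u * (\<sigma> ^^ (t + u)) z)"
      unfolding wedge_map_skew
      by (rule sum_periodic_shift[symmetric]) (simp add: wedge_coeff_period)
    also have "\<dots> = (\<Sum>u\<le>D. ?c u * (\<sigma> ^^ (t + u)) z)"
      by (rule sum.mono_neutral_right) (use assms in auto)
    finally show ?thesis by (simp add: add.commute[of t] funpow_add)
  qed
  have "?c u = 0" if "u \<le> D" for u
  proof (rule ccontr)
    assume "?c u \<noteq> 0"
    define f where "f = (\<lambda>i. if i < v then x i else y (i - v))"
    let ?Z = "{z. \<forall>i<2 * v. tr (f i * z) = 0}"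
    let ?S = "{z. (\<Sum>u\<le>D. ?c u * (\<sigma> ^^ u) z) = 0}"
    have "(\<sigma> ^^ t) ` ?Z \<subseteq> ?S"
    proof (rule image_subsetI)
      fix z assume z: "z \<in> ?Z"
      have "tr (x i * z) = 0 \<and> tr (y i * z) = 0" if "i < v" for i
      proof -
        have "tr (f i * z) = 0" "tr (f (v + i) * z) = 0" using z that by auto
        then show ?thesis using that by (simp add: f_def)
      qed
      then have "wedge_map x y v z = 0" by (simp add: wedge_map_def)
      then show "(\<sigma> ^^ t) z \<in> ?S" by (simp add: map_eq)
    qed
    then have "card ((\<sigma> ^^ t) ` ?Z) \<le> card ?S" by (intro card_mono) auto
    also have "\<dots> \<le> q ^ D" by (rule card_skew_kernel) (use \<open>?c u \<noteq> 0\<close> that in blast)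
    also have "card ((\<sigma> ^^ t) ` ?Z) = card ?Z"
      by (rule card_image) (rule inj_on_subset[OF inj_iter], simp)
    finally have "card ?Z * q ^ (2 * v) \<le> q ^ D * q ^ (2 * v)" by simp
    with card_common_kernel[where f = f and v = "2 * v"] have "q ^ N \<le> q ^ (D + 2 * v)"
      by (simp only: power_add order.trans)
    then show False
      using q_gt_1 \<open>D + 2 * v < N\<close> by (simp add: power_increasing_iff)
  qed
  then have "\<forall>z. wedge_map x y v z = 0" by (simp add: map_eq)
  then show ?thesis by (simp add: wedge_map_0_iff)
qed

text \<open>The annihilator of a \<open>w\<close>-dimensional span has \<open>q ^ (N - w)\<close>
  elements. If nothing separated \<open>x v\<close> from \<open>spn x v\<close>, the annihilators
  for \<open>v\<close> and \<open>Suc v\<close> would coincide, contradicting their sizes; a scalar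
  then normalizes the trace to 1.\<close>

lemma separating_element:
  assumes "indep x (Suc v)"
  obtains z where "\<And>u. u \<in> spn x v \<Longrightarrow> tr (u * z) = 0" "tr (x v * z) = 1"
proof -
  have ann: "card {z. \<forall>u\<in>spn x w. tr (u * z) = 0} * q ^ w = q ^ N" if "indep x w" for w
  proof -
    have "card {g \<in> spn x w. \<forall>h\<in>UNIV. tr (g * h) = 0} * card (UNIV :: 'a set)
        = card {h \<in> UNIV. \<forall>g\<in>spn x w. tr (g * h) = 0} * card (spn x w)"
    proof (rule card_annihilators[where q = q])
      fix g assume "\<exists>h\<in>UNIV. tr (g * h) \<noteq> 0"
      then have nz: "\<exists>h\<in>UNIV. tr (g * h) \<noteq> 0" .
      show "card {h \<in> UNIV. tr (g * h) = 0} * q = card (UNIV :: 'a set)"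
      proof (rule card_functional_kernel[where G = UNIV and f = "\<lambda>h. tr (g * h)", OF _ _ _ _ _ nz])
        show "\<exists>x'\<in>UNIV. tr (g * x') = c * tr (g * h)" if "c \<in> K" for h c
          using tr_scale[OF that, of "g * h"] by (intro bexI[of _ "c * h"]) (simp_all add: mult.left_commute)
      qed (auto simp: distrib_left tr_add tr_in_K)
    next
      fix h assume "\<exists>g\<in>spn x w. tr (g * h) \<noteq> 0"
      then have nz: "\<exists>g\<in>spn x w. tr (g * h) \<noteq> 0" .
      show "card {g \<in> spn x w. tr (g * h) = 0} * q = card (spn x w)"
      proof (rule card_functional_kernel[where f = "\<lambda>g. tr (g * h)", OF _ _ _ _ _ nz])
        show "\<exists>x'\<in>spn x w. tr (x' * h) = c * tr (g * h)" if "g \<in> spn x w" "c \<in> K" for g c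
          using tr_scale[OF that(2), of "g * h"] subsp_spn[of x w] that
          by (intro bexI[of _ "c * g"]) (simp_all add: mult.assoc subsp_def)
      qed (use subsp_spn[of x w] in \<open>auto simp: distrib_right tr_add tr_in_K subsp_def\<close>)
    qed (use q_gt_1 in auto)
    moreover have "{g \<in> spn x w. \<forall>h\<in>UNIV. tr (g * h) = 0} = {0}"
      using tr_nondegenerate subsp_spn[of x w] by (auto simp: subsp_def)
    ultimately show ?thesis using card_spn[OF that] by (simp add: card_field)
  qed
  have "\<exists>z. (\<forall>u\<in>spn x v. tr (u * z) = 0) \<and> tr (x v * z) \<noteq> 0"
  proof (rule ccontr)
    assume no: "\<not> ?thesis"
    have "{z. \<forall>u\<in>spn x (Suc v). tr (u * z) = 0} = {z. \<forall>u\<in>spn x v. tr (u * z) = 0}"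
    proof (intro Collect_cong iffI ballI)
      fix z u assume z: "\<forall>u\<in>spn x v. tr (u * z) = 0" and "u \<in> spn x (Suc v)"
      then obtain w s where "u = w + s * x v" "w \<in> spn x v" "s \<in> K" by auto
      then show "tr (u * z) = 0"
        using no z by (auto simp: distrib_right tr_add mult.assoc tr_scale)
    qed (use spn_mono_Suc in blast)
    moreover have "indep x v" using assms by (simp add: indep_Suc)
    moreover define C where "C = card {z. \<forall>u\<in>spn x v. tr (u * z) = 0}"
    ultimately have "C * q ^ Suc v = q ^ N" "C * q ^ v = q ^ N"
      using ann[OF assms] ann[of v] by simp_all
    moreover have "0 < q ^ N" using q_gt_1 by simp
    ultimately have "q ^ Suc v = q ^ v" by (metis mult_cancel1 mult_0 less_irrefl)
    then show False using q_gt_1 by simp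
  qed
  then obtain z where z: "\<And>u. u \<in> spn x v \<Longrightarrow> tr (u * z) = 0" "tr (x v * z) \<noteq> 0" by blast
  let ?c = "inverse (tr (x v * z))"
  have scale: "tr (u * (?c * z)) = ?c * tr (u * z)" for u
    using tr_scale[OF K_inverse[OF tr_in_K], of "x v * z" "u * z"] by (simp add: mult.left_commute)
  show thesis by (rule that[of "?c * z"]) (use z in \<open>simp_all add: scale\<close>)
qed

lemma wedge_map_add: "wedge_map x (\<lambda>i. y i + y' i) v z = wedge_map x y v z + wedge_map x y' v z"
  by (simp add: wedge_map_def distrib_right distrib_left tr_add sum.distrib algebra_simps)

lemma wedge_map_cong:
  "(\<And>i. i < v \<Longrightarrow> x i = x' i \<and> y i = y' i) \<Longrightarrow> wedge_map x y v z = wedge_map x' y' v z"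
  by (simp add: wedge_map_def)

text \<open>Bilinearity of the wedge: if \<open>w\<close> has coordinates \<open>s i\<close> with
  respect to \<open>x\<close>, the choice \<open>y i = s i * t\<close> represents the bivector of
  \<open>w\<close> and \<open>t\<close>.\<close>

lemma wedge_map_span:
  assumes "w \<in> spn x v"
  shows "\<exists>y. (\<forall>i\<ge>v. y i = 0) \<and> (\<forall>z. wedge_map x y v z = t * tr (w * z) + w * tr (t * z))"
  using assms
proof (induction v arbitrary: w)
  case 0
  then show ?case by (intro exI[of _ "\<lambda>_. 0"]) (simp add: wedge_map_def)
next
  case (Suc v)
  then obtain w' s where w: "w = w' + s * x v" "w' \<in> spn x v" "s \<in> K" by auto
  from Suc.IH[OF w(2)] obtain y where y: "\<forall>i\<ge>v. y i = 0"
    "\<forall>z. wedge_map x y v z = t * tr (w' * z) + w' * tr (t * z)" by blast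
  have "wedge_map x (y(v := s * t)) (Suc v) z = t * tr (w * z) + w * tr (t * z)" for z
  proof -
    have "wedge_map x (y(v := s * t)) v z = wedge_map x y v z" by (rule wedge_map_cong) auto
    then have "wedge_map x (y(v := s * t)) (Suc v) z = t * tr (w' * z) + w' * tr (t * z)
        + (x v * tr (s * t * z) + s * t * tr (x v * z))"
      using y by (simp add: wedge_map_def)
    then show ?thesis
      using w by (simp add: distrib_right distrib_left tr_add tr_scale mult.assoc add_ac mult.left_commute)
  qed
  moreover have "\<forall>i\<ge>Suc v. (y(v := s * t)) i = 0" using y by auto
  ultimately show ?case by blast
qed

definition wedge_kernel :: "(nat \<Rightarrow> 'a) \<Rightarrow> nat \<Rightarrow> (nat \<Rightarrow> 'a) set" where
  "wedge_kernel x v = {y. (\<forall>i\<ge>v. y i = 0) \<and> (\<forall>z. wedge_map x y v z = 0)}"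

text \<open>The solutions correspond to symmetric matrices over \<open>K\<close> expressing
  \<open>y\<close> through \<open>x\<close>. The count is inductive: the last entry is free in
  \<open>spn x (Suc v)\<close>, and each choice leaves a coset of the smaller kernel.\<close>

lemma card_wedge_kernel: "indep x v \<Longrightarrow> card (wedge_kernel x v) = (\<Prod>i<v. q ^ Suc i)"
proof (induction v)
  case 0
  have "wedge_kernel x 0 = {\<lambda>_. 0}" by (auto simp: wedge_kernel_def wedge_map_def)
  then show ?case by simp
next
  case (Suc v)
  \<comment> \<open>The possible first \<open>v\<close> entries once the last one is fixed to be
    \<open>t\<close>; the last wedge has been moved to the right-hand side, signs being irrelevant
    in characteristic 2.\<close>
  define F where "F t = {y. (\<forall>i\<ge>v. y i = 0) \<and>
      (\<forall>z. wedge_map x y v z = x v * tr (t * z) + t * tr (x v * z))}" for t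
  have step: "wedge_map x y (Suc v) z = wedge_map x y v z + (x v * tr (y v * z) + y v * tr (x v * z))" for y z
    by (simp add: wedge_map_def)
  \<comment> \<open>Evaluation at a \<open>z\<close> orthogonal to \<open>spn x v\<close> with
    \<open>tr (x v * z) = 1\<close> isolates \<open>y v\<close> and expresses it through the
    \<open>x i\<close> with coefficients in \<open>K\<close>.\<close>
  have in_span: "y v \<in> spn x (Suc v)" if y: "y \<in> wedge_kernel x (Suc v)" for y
  proof -
    obtain z where z: "\<And>u. u \<in> spn x v \<Longrightarrow> tr (u * z) = 0" "tr (x v * z) = 1"
      using separating_element[OF Suc.prems] by blast
    have "tr (x i * z) = 0" if "i < v" for i
      using z(1) spn_generator[OF that] by blast
    then have "wedge_map x y v z = (\<Sum>i<v. x i * tr (y i * z))"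
      by (simp add: wedge_map_def)
    moreover have "wedge_map x y (Suc v) z = 0" using y by (simp add: wedge_kernel_def)
    ultimately have "(\<Sum>i<Suc v. x i * tr (y i * z)) + y v = 0"
      using z(2) by (simp add: step add.assoc)
    then have "y v = (\<Sum>i<Suc v. x i * tr (y i * z))"
      by (simp only: add_eq_0_iff')
    also have "\<dots> \<in> spn x (Suc v)"
    proof (rule subsp_sum[OF subsp_spn])
      fix i assume "i \<in> {..<Suc v}"
      then have "tr (y i * z) * x i \<in> spn x (Suc v)"
        using subsp_spn[of x "Suc v"] spn_generator[of i "Suc v" x] tr_in_K
        unfolding subsp_def by blast
      then show "x i * tr (y i * z) \<in> spn x (Suc v)" by (simp only: mult.commute)
    qed
    finally show ?thesis .
  qed
  have "bij_betw (\<lambda>(t, y). y(v := t)) (Sigma (spn x (Suc v)) F) (wedge_kernel x (Suc v))"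
  proof (rule bij_betw_byWitness[where f' = "\<lambda>y. (y v, y(v := 0))"])
    have upd: "wedge_map x (y(v := t)) v z = wedge_map x y v z" for y t z
      by (rule wedge_map_cong) auto
    show "(\<lambda>(t, y). y(v := t)) ` Sigma (spn x (Suc v)) F \<subseteq> wedge_kernel x (Suc v)"
      by (auto simp: F_def wedge_kernel_def step upd simp del: spn.simps)
    show "(\<lambda>y. (y v, y(v := 0))) ` wedge_kernel x (Suc v) \<subseteq> Sigma (spn x (Suc v)) F"
      using in_span
      by (auto simp: F_def wedge_kernel_def step upd add_eq_0_iff' simp del: spn.simps)
  qed (auto simp: F_def wedge_kernel_def fun_eq_iff)
  then have "card (wedge_kernel x (Suc v)) = card (Sigma (spn x (Suc v)) F)"
    by (simp only: bij_betw_same_card)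
  also have "\<dots> = (\<Sum>t\<in>spn x (Suc v). card (F t))"
  proof (rule card_SigmaI)
    show "\<forall>t\<in>spn x (Suc v). finite (F t)"
      using finite_subset[OF _ finite_supported[of v]] by (auto simp: F_def)
  qed simp
  also have "\<dots> = (\<Sum>t\<in>spn x (Suc v). card (wedge_kernel x v))"
  proof (rule sum.cong)
    fix t assume "t \<in> spn x (Suc v)"
    then obtain w s where t: "t = w + s * x v" "w \<in> spn x v" "s \<in> K" by auto
    \<comment> \<open>\<open>y0\<close> is a particular solution for \<open>w\<close>, and also for
      \<open>t\<close>: the part \<open>s * x v\<close> contributes nothing, since its wedge with
      \<open>x v\<close> is zero. Translation by \<open>y0\<close> then identifies
      \<open>F t\<close> with the kernel.\<close>
    obtain y0 where y0: "\<forall>i\<ge>v. y0 i = 0"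
      "\<forall>z. wedge_map x y0 v z = x v * tr (w * z) + w * tr (x v * z)"
      using wedge_map_span[OF t(2)] by blast
    have F: "F t = {y. (\<forall>i\<ge>v. y i = 0) \<and> (\<forall>z. wedge_map x y v z = wedge_map x y0 v z)}"
      unfolding F_def using y0 t
      by (simp add: distrib_right distrib_left tr_add tr_scale mult.assoc mult.left_commute add_ac)
    have inv: "y i + y0 i + y0 i = y i" for y i by (simp add: add.assoc)
    have "bij_betw (\<lambda>y i. y i + y0 i) (F t) (wedge_kernel x v)"
      by (rule bij_betw_byWitness[where f' = "\<lambda>y i. y i + y0 i"])
         (use y0(1) in \<open>auto simp: F wedge_kernel_def wedge_map_add inv simp del: minus_eq\<close>)
    then show "card (F t) = card (wedge_kernel x v)" by (rule bij_betw_same_card)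
  qed simp
  also have "\<dots> = q ^ Suc v * card (wedge_kernel x v)"
    by (simp only: sum_constant card_spn[OF Suc.prems] of_nat_id)
  finally show ?case using Suc by (simp add: indep_Suc)
qed

section \<open>Even codimension of the radical of an alternating form\<close>

text \<open>Hyperbolic planes are split off one at a time. Each contributes a factor
  \<open>q ^ 2\<close>, and its orthogonal complement has the same radical.\<close>

lemma card_modulo_radical:
  assumes "subsp V"
    and add: "\<And>x y z. B (x + y) z = B x z + B y z"
    and scale: "\<And>c x y. c \<in> K \<Longrightarrow> B (c * x) y = c * B x y"
    and sym: "\<And>x y. B x y = B y x"
    and alt: "\<And>x. B x x = 0"
    and in_K: "\<And>x y. B x y \<in> K"
  shows "\<exists>s. card V = card {x \<in> V. \<forall>y\<in>V. B x y = 0} * q ^ (2 * s)"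
  using assms(1)
proof (induction "card V" arbitrary: V rule: less_induct)
  case less
  show ?case
  proof (cases "\<forall>x\<in>V. \<forall>y\<in>V. B x y = 0")
    case True
    then have "{x \<in> V. \<forall>y\<in>V. B x y = 0} = V" by auto
    then show ?thesis by (intro exI[of _ 0]) simp
  next
    case False
    then obtain x y0 where "x \<in> V" "y0 \<in> V" "B x y0 \<noteq> 0" by blast
    define y where "y = inverse (B x y0) * y0"
    have "x \<in> V" by fact
    have "y \<in> V"
      using less.prems \<open>y0 \<in> V\<close> in_K[of x y0] by (simp add: y_def subsp_def K_inverse)
    have "B y x = 1"
      using \<open>B x y0 \<noteq> 0\<close> in_K[of x y0] by (simp add: y_def scale K_inverse sym[of y0 x])
    then have "B x y = 1" by (simp add: sym[of x y])
    define W where "W = {v \<in> V. B v x = 0 \<and> B v y = 0}"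
    have subW: "subsp W"
      using less.prems add[of 0 0] by (auto simp: W_def subsp_def add scale)
    \<comment> \<open>Orthogonal projection onto \<open>W\<close>: because \<open>B x y = 1\<close>
      and the form is alternating, the coordinates of \<open>v\<close> along \<open>x\<close> and
      \<open>y\<close> are \<open>B v y\<close> and \<open>B v x\<close>.\<close>
    have comp: "v + B v y * x + B v x * y \<in> W" if "v \<in> V" for v
      using that less.prems \<open>x \<in> V\<close> \<open>y \<in> V\<close> in_K \<open>B x y = 1\<close> \<open>B y x = 1\<close>
      by (simp add: W_def subsp_def add scale alt)
    let ?g = "\<lambda>(a, b, v). v + a * x + b * y"
    have "bij_betw ?g (K \<times> K \<times> W) V"
    proof (rule bij_betw_byWitness[where f' = "\<lambda>v. (B v y, B v x, v + B v y * x + B v x * y)"])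
      show "?g ` (K \<times> K \<times> W) \<subseteq> V"
        using less.prems \<open>x \<in> V\<close> \<open>y \<in> V\<close> by (auto simp: W_def subsp_def)
      show "(\<lambda>v. (B v y, B v x, v + B v y * x + B v x * y)) ` V \<subseteq> K \<times> K \<times> W"
        using in_K comp by auto
      have cancel: "a + b + c + b + c = a" for a b c :: 'a
      proof -
        have "a + b + c + b + c = a + (b + b) + (c + c)" by (simp only: add_ac)
        then show ?thesis by simp
      qed
      show "\<forall>p\<in>K \<times> K \<times> W. (B (?g p) y, B (?g p) x, ?g p + B (?g p) y * x + B (?g p) x * y) = p"
        using \<open>B x y = 1\<close> \<open>B y x = 1\<close> by (auto simp: W_def add scale alt cancel)
      show "\<forall>v\<in>V. ?g (B v y, B v x, v + B v y * x + B v x * y) = v"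
        by (simp add: cancel)
    qed
    then have "card V = card (K \<times> K \<times> W)" by (simp only: bij_betw_same_card)
    then have cardV: "card V = q ^ 2 * card W"
      by (simp add: card_cartesian_product card_K power2_eq_square)
    have "card W > 0" using subW by (auto simp: card_gt_0_iff subsp_def)
    then have "card W < card V"
      using cardV one_less_power[OF q_gt_1, of 2] by simp
    from less.hyps[OF this subW] obtain s where
      s: "card W = card {u \<in> W. \<forall>v\<in>W. B u v = 0} * q ^ (2 * s)" by blast
    have "{u \<in> W. \<forall>v\<in>W. B u v = 0} = {u \<in> V. \<forall>v\<in>V. B u v = 0}"
    proof (intro equalityI subsetI)
      fix u assume u: "u \<in> {u \<in> W. \<forall>v\<in>W. B u v = 0}"
      have "B u v = 0" if "v \<in> V" for v
      proof -
        have "B u (v + B v y * x + B v x * y) = 0" using u comp[OF that] by blast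
        then have "B v u + B v y * B x u + B v x * B y u = 0"
          using in_K by (simp add: sym[of u] add scale)
        then show ?thesis using u by (simp add: W_def sym[of _ u])
      qed
      then show "u \<in> {u \<in> V. \<forall>v\<in>V. B u v = 0}" using u by (simp add: W_def)
    qed (use \<open>x \<in> V\<close> \<open>y \<in> V\<close> in \<open>auto simp: W_def\<close>)
    then have "card V = card {u \<in> V. \<forall>v\<in>V. B u v = 0} * q ^ (2 * Suc s)"
      using cardV s by (simp add: power_add mult_ac power2_eq_square)
    then show ?thesis by blast
  qed
qed

end

section \<open>The forms and their rank distribution\<close>

lemma char_eq_2:
  assumes "card (UNIV :: 'a::{field,finite} set) = 2 ^ m"
  shows "CHAR('a) = 2"
proof -
  have "CHAR('a) dvd 2 ^ m" using CHAR_dvd_CARD[where 'a = 'a] assms by simp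
  moreover have "prime CHAR('a)"
    by (rule prime_CHAR_semidom) (rule finite_imp_CHAR_pos, simp)
  ultimately have "CHAR('a) dvd 2" using prime_dvd_power by blast
  then show ?thesis
    using primes_dvd_imp_eq[OF \<open>prime CHAR('a)\<close> two_is_prime_nat] by blast
qed

lemma frobenius_add:
  assumes "card (UNIV :: 'a::{field,finite} set) = 2 ^ m"
  shows "(x + y :: 'a) ^ (2 ^ s) = x ^ (2 ^ s) + y ^ (2 ^ s)"
  by (rule freshmans_dream') (simp_all add: char_eq_2[OF assms])

lemma frobenius_sum:
  assumes "card (UNIV :: 'a::{field,finite} set) = 2 ^ m"
  shows "(sum f A :: 'a) ^ (2 ^ s) = (\<Sum>i\<in>A. f i ^ (2 ^ s))"
  by (rule freshmans_dream_sum') (simp_all add: char_eq_2[OF assms])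

lemma power_card_finite_field: "(x :: 'a::{field,finite}) ^ card (UNIV :: 'a set) = x"
proof (cases "x = 0")
  case True
  then show ?thesis by (simp add: card_gt_0_iff)
next
  case False
  let ?U = "UNIV - {0 :: 'a}"
  have "bij_betw (\<lambda>y. x * y) ?U ?U"
    by (rule bij_betw_byWitness[where f' = "\<lambda>y. y / x"]) (use False in auto)
  then have "prod (\<lambda>y. x * y) ?U = prod (\<lambda>y. y) ?U"
    by (rule prod.reindex_bij_betw)
  then have "x ^ card ?U * prod (\<lambda>y. y) ?U = prod (\<lambda>y. y) ?U"
    by (simp only: prod.distrib prod_constant)
  moreover have "prod (\<lambda>y. y) ?U \<noteq> 0" by (simp add: prod_zero_iff)
  ultimately have "x ^ card ?U = 1" by (metis mult_cancel_right1 mult.commute)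
  moreover have "card (UNIV :: 'a set) = Suc (card ?U)"
    using card_Suc_Diff1[of UNIV "0 :: 'a"] by (simp only: finite UNIV_I)
  ultimately show ?thesis by (simp only: power_Suc mult_1_right)
qed

lemma frobenius_period:
  assumes "card (UNIV :: 'a::{field,finite} set) = 2 ^ m"
  shows "(x :: 'a) ^ (2 ^ (m * t + s)) = x ^ (2 ^ s)"
proof -
  have base: "x ^ (2 ^ m) = x" for x :: 'a
    using power_card_finite_field[of x] by (simp only: assms)
  have "x ^ (2 ^ (m * t)) = x"
    by (induction t) (simp_all only: mult_Suc_right power_add power_mult[of x] base mult_0_right
        power_0 power_one_right)
  then show ?thesis by (simp only: power_add power_mult[of x])
qed

lemma frobenius_iter: "((\<lambda>x::'a::monoid_mult. x ^ (2 ^ d)) ^^ s) x = x ^ (2 ^ (d * s))"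
  by (induction s) (simp_all add: power_mult[symmetric] power_add[symmetric] add.commute)

text \<open>The upper bound counts roots of \<open>X ^ (2 ^ e) - X\<close>. For the lower bound, the
  trace \<open>T\<close> maps into the fixed field, and its kernel consists of roots of a polynomial
  of degree at most \<open>2 ^ (e * (N - 1))\<close>, so its image has at least \<open>2 ^ e\<close>
  elements.\<close>

lemma card_fixed_frobenius:
  assumes card: "card (UNIV :: 'a::{field,finite} set) = 2 ^ m" and "0 < e" "e dvd m" "0 < m"
  shows "card {x :: 'a. x ^ (2 ^ e) = x} = 2 ^ e"
proof (rule antisym)
  let ?K = "{x :: 'a. x ^ (2 ^ e) = x}"
  let ?p = "monom 1 (2 ^ e) - monom 1 1 :: 'a poly"
  have "1 < (2::nat) ^ e" by (rule one_less_power) (use \<open>0 < e\<close> in simp_all)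
  then have ne: "1 \<noteq> (2::nat) ^ e" by (rule less_imp_neq)
  have lead: "coeff ?p (2 ^ e) = 1" by (simp only: coeff_diff coeff_monom ne refl if_True if_False diff_zero)
  have "?p \<noteq> 0"
  proof
    assume "?p = 0"
    with lead show False by (simp only: coeff_0 zero_neq_one)
  qed
  moreover have "degree ?p \<le> 2 ^ e"
    by (rule degree_diff_le) (use \<open>0 < e\<close> in \<open>simp_all add: degree_monom_eq\<close>)
  ultimately have "card {x. poly ?p x = 0} \<le> 2 ^ e"
    using card_poly_roots_bound[of ?p] by simp
  then show "card ?K \<le> 2 ^ e" by (simp add: poly_monom)
  obtain N where m: "m = e * N" using \<open>e dvd m\<close> by (auto simp: dvd_def)
  with \<open>0 < m\<close> obtain N' where N: "N = Suc N'" by (cases N) auto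
  define T where "T = (\<lambda>x :: 'a. \<Sum>i<N. x ^ (2 ^ (e * i)))"
  have T_add: "T (x + y) = T x + T y" for x y
    by (simp add: T_def frobenius_add[OF card] sum.distrib)
  have "T x \<in> ?K" for x
  proof -
    have "T x ^ (2 ^ e) = (\<Sum>i<N. x ^ (2 ^ (e * (1 + i))))"
      by (simp add: T_def frobenius_sum[OF card] power_mult[symmetric] power_add[symmetric] add.commute)
    also have "\<dots> = T x"
      unfolding T_def
      by (rule sum_periodic_shift)
         (use frobenius_period[OF card, of x 1] in \<open>simp add: m distrib_left add.commute\<close>)
    finally show ?thesis by simp
  qed
  then have image: "card (T ` UNIV) \<le> card ?K" by (intro card_mono) auto
  let ?t = "\<Sum>i<N. monom 1 (2 ^ (e * i)) :: 'a poly"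
  have inj: "(2::nat) ^ (e * i) = 2 ^ (e * j) \<longleftrightarrow> i = j" for i j
    using \<open>0 < e\<close> by simp
  have "coeff ?t (2 ^ (e * N')) = (\<Sum>i<N. if i = N' then 1 else 0)"
    by (simp only: coeff_sum coeff_monom inj)
  also have "\<dots> = 1" using N by simp
  finally have "?t \<noteq> 0" by auto
  moreover have "degree ?t \<le> 2 ^ (e * N')"
    by (rule degree_sum_le) (use N in \<open>auto simp: degree_monom_eq intro!: power_increasing\<close>)
  ultimately have "card {x. poly ?t x = 0} \<le> 2 ^ (e * N')"
    using card_poly_roots_bound[of ?t] by simp
  then have ker: "card {x \<in> UNIV. T x = 0} \<le> 2 ^ (e * N')"
    by (simp add: T_def poly_sum poly_monom)
  have "2 ^ e * 2 ^ (e * N') = card (UNIV :: 'a set)"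
    by (simp add: card m N power_add)
  also have "\<dots> = card (T ` UNIV) * card {x \<in> UNIV. T x = 0}"
    by (rule card_image_kernel) (simp_all add: T_add)
  also have "\<dots> \<le> card ?K * 2 ^ (e * N')"
    using image ker by (rule mult_le_mono)
  finally show "2 ^ e \<le> card ?K" by simp
qed

text \<open>Bezout gives \<open>d * u = m * v + gcd d m\<close>, and exponents may be reduced modulo
  \<open>m\<close>; the converse holds because the gcd divides \<open>d\<close>.\<close>

lemma fixed_frobenius_gcd:
  assumes card: "card (UNIV :: 'a::{field,finite} set) = 2 ^ m" and "0 < d"
  shows "{x :: 'a. x ^ (2 ^ d) = x} = {x. x ^ (2 ^ gcd m d) = x}"
proof (intro equalityI subsetI CollectI)
  have iter: "x ^ (2 ^ (s * t)) = x" if "x ^ (2 ^ s) = x" for x :: 'a and s t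
    by (induction t) (simp_all only: mult_Suc_right power_add power_mult[of x] that mult_0_right
        power_0 power_one_right)
  fix x :: 'a
  {
    assume "x \<in> {x. x ^ (2 ^ d) = x}"
    obtain u v where uv: "d * u = m * v + gcd d m"
      using bezout_nat[of d m] \<open>0 < d\<close> by auto
    have "x = x ^ (2 ^ (d * u))" using iter \<open>x \<in> _\<close> by simp
    also have "\<dots> = x ^ (2 ^ gcd m d)"
      by (simp only: uv frobenius_period[OF card] gcd.commute)
    finally show "x ^ (2 ^ gcd m d) = x" by simp
  next
    assume "x \<in> {x. x ^ (2 ^ gcd m d) = x}"
    then show "x ^ (2 ^ d) = x"
      using iter[of x "gcd m d" "d div gcd m d"] by simp
  }
qed

lemma cyclic_ext_frobenius:
  assumes card: "card (UNIV :: 'a::{field,finite} set) = 2 ^ m"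
    and "0 < m" "0 < d" "e = gcd m d"
  shows "cyclic_ext (\<lambda>x :: 'a. x ^ (2 ^ d)) (2 ^ e) (m div e)"
proof
  have "0 < e" "e dvd m" "e dvd d" using assms by auto
  show "card {x :: 'a. x ^ (2 ^ d) = x} = 2 ^ e"
    using fixed_frobenius_gcd[OF card \<open>0 < d\<close>] card_fixed_frobenius[OF card \<open>0 < e\<close> \<open>e dvd m\<close> \<open>0 < m\<close>]
    by (simp add: \<open>e = gcd m d\<close>)
  show "card (UNIV :: 'a set) = (2 ^ e) ^ (m div e)"
    using \<open>e dvd m\<close> by (simp add: card power_mult[symmetric])
  show "0 < m div e" using \<open>0 < m\<close> \<open>0 < e\<close> \<open>e dvd m\<close> by (auto elim!: dvdE)
  \<comment> \<open>The iterate therefore has an exponent divisible by \<open>m\<close>, hence is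
    the identity.\<close>
  have "d * (m div e) = m * (d div e)"
    using \<open>e dvd m\<close> \<open>e dvd d\<close> by (metis div_mult_swap mult.commute)
  then show "((\<lambda>x :: 'a. x ^ (2 ^ d)) ^^ (m div e)) x = x" for x :: 'a
    using frobenius_period[OF card, of x "d div e" 0] by (simp add: frobenius_iter)
  show "(1 :: 'a) + 1 = 0"
    using char_eq_2[OF card] of_nat_CHAR[where 'a = 'a] by simp
  show "1 < (2::nat) ^ e" by (rule one_less_power) (use \<open>0 < e\<close> in simp_all)
qed (simp_all add: frobenius_add[OF card] power_mult_distrib)

lemma sum_symmetric_window:
  fixes f :: "nat \<Rightarrow> 'b::comm_monoid_add"
  assumes "1 \<le> k" "k \<le> M"
  shows "sum f {M + 1 - k..<M + k} = f M + (\<Sum>j\<in>{1..<k}. f (M - j) + f (M + j))"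
  using assms
proof (induction k rule: nat_induct_at_least)
  case (Suc k)
  then have "{M + 1 - Suc k..<M + Suc k} = insert (M - k) (insert (M + k) {M + 1 - k..<M + k})"
    by auto
  moreover have "M - k \<noteq> M + k" "M - k \<notin> {M + 1 - k..<M + k}" using Suc by auto
  moreover have "{1..<Suc k} = insert k {1..<k}" using Suc by auto
  ultimately show ?case using Suc by (simp add: add_ac)
qed simp

section \<open>The form as a trace pairing with a skew polynomial\<close>

locale twisted_forms =
  fixes m n d e k :: nat and field_type :: "'a::{field,finite} itself"
  assumes card_univ: "card (UNIV :: 'a set) = 2 ^ m"
    and n_pos: "0 < n" and d_pos: "0 < d" and m_def: "m = 2 * n"
    and e_def: "e = gcd n d" and e_def': "e = gcd m d"
    and k_pos: "1 \<le> k" and k_le: "k \<le> n div e"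
begin

definition M :: nat where "M = n div e"

lemma e_pos: "0 < e" and e_dvd: "e dvd n" "e dvd m" "e dvd d"
  using n_pos d_pos by (auto simp: e_def m_def)

lemma m_pos: "0 < m" using n_pos m_def by simp

lemma n_eq: "e * M = n" and m_div_e: "m div e = 2 * M"
  using e_dvd(1) e_pos by (auto simp: M_def m_def)

sublocale cyclic_ext "\<lambda>x :: 'a. x ^ (2 ^ d)" "2 ^ e" "m div e"
  by (rule cyclic_ext_frobenius[OF card_univ m_pos d_pos e_def'])

text \<open>\<open>trace2\<close> runs along powers of the \<open>2 ^ e\<close> Frobenius, so trace
  facts come from this second instance; \<open>F_K\<close> shows that both have the same fixed
  field.\<close>

sublocale F: cyclic_ext "\<lambda>x :: 'a. x ^ (2 ^ e)" "2 ^ e" "m div e"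
  by (rule cyclic_ext_frobenius[OF card_univ m_pos e_pos])
     (use e_dvd in \<open>simp add: gcd_nat.absorb2\<close>)

abbreviation sg :: "nat \<Rightarrow> 'a \<Rightarrow> 'a" where "sg s x \<equiv> ((\<lambda>x. x ^ (2 ^ d)) ^^ s) x"

abbreviation Tm :: "'a \<Rightarrow> 'a" where "Tm \<equiv> trace2 m e"
abbreviation Tn :: "'a \<Rightarrow> 'a" where "Tn \<equiv> trace2 n e"
abbreviation B :: "(nat \<Rightarrow> 'a) \<Rightarrow> 'a \<Rightarrow> 'a \<Rightarrow> 'a" where "B \<equiv> Bform m n d e k"
abbreviation L0 :: "'a set" where "L0 \<equiv> subfield_of_order n"

lemma F_K: "F.K = K"
  using fixed_frobenius_gcd[OF card_univ d_pos] unfolding F.K_def K_def e_def'[symmetric] by simp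

lemma Tm_eq: "Tm = F.tr"
  by (rule ext) (simp add: trace2_def F.tr_def frobenius_iter)

lemma Tm_add: "Tm (x + y) = Tm x + Tm y" and Tm_in_K: "Tm x \<in> K"
  and Tm_scale: "c \<in> K \<Longrightarrow> Tm (c * x) = c * Tm x"
  and Tm_sum: "Tm (sum f A) = (\<Sum>i\<in>A. Tm (f i))"
  using F.tr_add F.tr_in_K F.tr_scale F.tr_sum by (simp_all add: Tm_eq F_K)

lemma Tm_nondegenerate: "(\<And>y. Tm (x * y) = 0) \<Longrightarrow> x = 0"
  unfolding Tm_eq by (rule F.tr_nondegenerate)

lemma Tn_add: "Tn (x + y) = Tn x + Tn y"
  by (simp add: trace2_def frobenius_add[OF card_univ] sum.distrib)

lemma Tn_0 [simp]: "Tn 0 = 0"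
  using Tn_add[of 0 0] by (simp only: add_0_left self_add)

lemma Tn_sum: "Tn (sum f A) = (\<Sum>i\<in>A. Tn (f i))"
  by (induction A rule: infinite_finite_induct) (simp_all add: Tn_add)

text \<open>Since \<open>e\<close> divides \<open>d\<close>, \<open>sg s\<close> is an iterate of
  the \<open>2 ^ e\<close> Frobenius, which only rotates the summands of the trace.\<close>

lemma Tm_frobenius: "Tm (sg s x) = Tm x"
proof -
  have "Tm (x ^ (2 ^ (e * t))) = Tm x" for x t
  proof (induction t)
    case (Suc t)
    have "Tm (x ^ 2 ^ (e * Suc t)) = (\<Sum>i<m div e. (x ^ (2 ^ (e * t))) ^ (2 ^ (e * (1 + i))))"
      by (simp add: trace2_def power_mult[symmetric] power_add[symmetric] add_ac)
    also have "\<dots> = Tm (x ^ (2 ^ (e * t)))"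
    proof -
      have "e * (s + m div e) = m * 1 + e * s" for s
        using e_dvd(2) by (simp add: distrib_left)
      then show ?thesis
        unfolding trace2_def
        by (intro sum_periodic_shift) (simp only: frobenius_period[OF card_univ])
    qed
    finally show ?case using Suc by simp
  qed simp
  from this[of x "(d div e) * s"] show ?thesis
    using e_dvd by (simp add: frobenius_iter mult.assoc[symmetric])
qed

text \<open>\<open>d div e\<close> is coprime to the even number \<open>m div e\<close>, hence odd,
  so \<open>d * M\<close> is congruent to \<open>n\<close> modulo \<open>m\<close>. Thus
  \<open>sg M\<close> is the involution with fixed field \<open>L0\<close>.\<close>

lemma sg_M: "sg M x = x ^ (2 ^ n)"
proof -
  have "odd (d div e)"
  proof
    assume "even (d div e)"
    moreover have "even (m div e)" by (simp add: m_div_e)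
    moreover have "coprime (m div e) (d div e)"
      unfolding e_def' by (rule div_gcd_coprime) (use m_pos in simp)
    ultimately show False using coprime_common_divisor_nat[of "m div e" "d div e" 2] by simp
  qed
  then obtain c where "d div e = 2 * c + 1" by (rule oddE)
  then have d: "d = e * (2 * c + 1)" using dvd_mult_div_cancel[OF e_dvd(3)] by simp
  have "d * M = 2 * (e * M) * c + e * M" unfolding d by (simp add: algebra_simps)
  then have "d * M = m * c + n" by (simp only: m_def n_eq)
  then show ?thesis
    by (simp only: frobenius_iter frobenius_period[OF card_univ])
qed

lemma sg_sg: "sg s (sg t x) = sg (s + t) x"
  by (simp add: funpow_add)

lemma sg_N: "sg (2 * M) x = x"
  using \<sigma>_period[of x] by (simp add: m_div_e)

lemma L0_iff: "x \<in> L0 \<longleftrightarrow> sg M x = x"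
  by (simp only: subfield_of_order_def sg_M mem_Collect_eq)

lemma Tm_Tn: "Tm x = Tn (x + sg M x)"
proof -
  have split: "(\<Sum>i<M + l. f i) = (\<Sum>i<M. f i) + (\<Sum>i<l. f (M + i))" for f :: "nat \<Rightarrow> 'a" and l
    by (induction l) (simp_all add: add.assoc)
  have "n div e = M" by (simp only: M_def)
  have "sg M x ^ (2 ^ (e * i)) = x ^ (2 ^ (e * (M + i)))" for i
    by (simp only: sg_M n_eq distrib_left power_add power_mult[of x])
  then show ?thesis
    by (simp only: Tn_add) (simp only: trace2_def m_div_e mult_2 split \<open>n div e = M\<close>)
qed

text \<open>For \<open>c\<close> in \<open>L0\<close>, transitivity of the trace gives
  \<open>Tm (c * z) = Tn (c * (z + sg M z))\<close>, and \<open>z + sg M z\<close> lies in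
  \<open>L0\<close>; nondegeneracy of \<open>Tm\<close> applies.\<close>

lemma Tn_nondegenerate:
  assumes "c \<in> L0" and "\<And>a. a \<in> L0 \<Longrightarrow> Tn (a * c) = 0"
  shows "c = 0"
proof (rule Tm_nondegenerate)
  fix z
  have "z + sg M z \<in> L0"
    by (simp only: L0_iff iter_add sg_sg mult_2[symmetric] sg_N add.commute)
  from assms(2)[OF this] show "Tm (c * z) = 0"
    using assms(1) by (simp only: Tm_Tn L0_iff iter_mult distrib_left mult.commute)
qed

lemma B_eq: "B a x y = Tn (a 0 * (x * sg M y + sg M x * y))
    + (\<Sum>j\<in>{1..<k}. Tm (a j * (x * sg (M - j) y + sg (M - j) x * y)))"
proof -
  have "n * d div e = d * M" using e_dvd(1) by (simp add: M_def div_mult_swap mult.commute)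
  then show ?thesis
    by (simp add: Bform_def frobenius_iter M_def mult.commute)
qed

text \<open>The element representing \<open>B a x\<close> under the trace form. The adjoint of
  \<open>a j * sg (M - j) x\<close> is \<open>sg (M + j) (a j * x)\<close> because
  \<open>sg (2 * M)\<close> is the identity.\<close>

definition skew :: "(nat \<Rightarrow> 'a) \<Rightarrow> 'a \<Rightarrow> 'a" where
  "skew a x = a 0 * sg M x + (\<Sum>j\<in>{1..<k}. a j * sg (M - j) x + sg (M + j) (a j * x))"

lemma k_le_M: "k \<le> M" using k_le by (simp add: M_def)

text \<open>For the middle term, \<open>a 0 \<in> L0\<close> makes the argument of \<open>Tn\<close>
  a sum \<open>u + sg M u\<close>, so \<open>Tn\<close> becomes \<open>Tm u\<close>. In the others,
  applying \<open>sg (M + j)\<close> inside the trace frees \<open>y\<close> of its twist.\<close>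

lemma B_skew:
  assumes "a 0 \<in> L0"
  shows "B a x y = Tm (y * skew a x)"
proof -
  have "Tn (a 0 * (x * sg M y + sg M x * y)) = Tm (y * (a 0 * sg M x))"
    using assms by (simp add: Tm_Tn L0_iff iter_mult sg_sg sg_N algebra_simps flip: mult_2)
  moreover have "Tm (a j * (x * sg (M - j) y + sg (M - j) x * y))
      = Tm (y * (a j * sg (M - j) x + sg (M + j) (a j * x)))" if "j \<in> {1..<k}" for j
  proof -
    have "M + j + (M - j) = 2 * M" using that k_le_M by auto
    then have "sg (M + j) (a j * x * sg (M - j) y) = sg (M + j) (a j * x) * y"
      by (simp only: iter_mult sg_sg sg_N)
    then have "Tm (a j * x * sg (M - j) y) = Tm (sg (M + j) (a j * x) * y)"
      by (metis Tm_frobenius)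
    then show ?thesis
      by (simp only: distrib_left Tm_add mult.assoc mult.commute[of y] add.commute)
  qed
  ultimately show ?thesis
    by (simp add: B_eq skew_def distrib_left sum_distrib_left Tm_add Tm_sum)
qed

lemma Brad_skew:
  assumes "a 0 \<in> L0"
  shows "Brad m n d e k a = {x. skew a x = 0}"
  using Tm_nondegenerate[of "skew a _"]
  by (auto simp: Brad_def B_skew[of a, OF assms] mult.commute Tm_eq)

lemma skew_add: "skew a (x + y) = skew a x + skew a y"
  by (simp add: skew_def iter_add distrib_left sum.distrib add_ac)

lemma skew_scale: "c \<in> K \<Longrightarrow> skew a (c * x) = c * skew a x"
  by (simp add: skew_def iter_mult iter_K distrib_left sum_distrib_left mult_ac)

lemma skew_scale_coeff: "c \<in> K \<Longrightarrow> skew (\<lambda>i. c * a i) x = c * skew a x"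
  by (simp add: skew_def iter_mult iter_K distrib_left sum_distrib_left mult_ac)

lemma B_sym: "B a x y = B a y x"
  unfolding B_eq by (simp only: mult.commute add.commute)

lemma B_alt: "B a x x = 0"
  by (simp add: B_eq mult.commute Tm_eq)

lemma subsp_Brad:
  assumes "a 0 \<in> L0"
  shows "subsp (Brad m n d e k a)"
proof -
  have "skew a 0 = 0" using skew_scale[of 0 a 0] by simp
  then show ?thesis
    by (simp add: Brad_skew[of a, OF assms] subsp_def skew_add skew_scale)
qed

lemma card_Brad_parity:
  assumes "a 0 \<in> L0"
  obtains j where "card (Brad m n d e k a) = 2 ^ (e * (2 * j))" "j \<le> M"
proof -
  have "\<exists>s. card (UNIV :: 'a set) = card {x \<in> UNIV. \<forall>y\<in>UNIV. B a x y = 0} * (2 ^ e) ^ (2 * s)"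
  proof (rule card_modulo_radical[OF subsp_UNIV])
    show "B a (x + y) z = B a x z + B a y z" for x y z
      by (simp add: B_skew[of a, OF assms] skew_add distrib_left Tm_add)
    show "B a (c * x) y = c * B a x y" if "c \<in> K" for c x y
      using that by (simp add: B_skew[of a, OF assms] skew_scale mult.left_commute Tm_scale)
    show "B a x y = B a y x" for x y by (rule B_sym)
    show "B a x x = 0" for x by (rule B_alt)
    show "B a x y \<in> K" for x y by (simp add: B_skew[of a, OF assms] Tm_in_K)
  qed
  then obtain s where s: "2 ^ m = card (Brad m n d e k a) * 2 ^ (e * (2 * s))"
    by (auto simp: card_univ Brad_def power_mult)
  have m_eq: "m = e * (2 * M)" using m_div_e e_dvd by (metis dvd_mult_div_cancel)
  have pos: "0 < card (Brad m n d e k a)"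
    using s by (metis gr0I mult_0 power_not_zero zero_neq_numeral)
  have "(2::nat) ^ (e * (2 * s)) \<le> 2 ^ m" using s pos by simp
  then have "s \<le> M" using e_pos by (simp add: m_eq)
  then have "m = e * (2 * (M - s)) + e * (2 * s)"
    by (simp add: m_eq flip: distrib_left)
  then have "2 ^ (e * (2 * (M - s))) * 2 ^ (e * (2 * s)) = card (Brad m n d e k a) * 2 ^ (e * (2 * s))"
    using s by (simp add: power_add)
  then have "card (Brad m n d e k a) = 2 ^ (e * (2 * (M - s)))" by simp
  then show thesis by (rule that) simp
qed

text \<open>Composing with the bijection \<open>sg ?t\<close> turns the radical into the kernel of a
  nonzero skew polynomial of degree at most \<open>2 * (k - 1)\<close>.\<close>

lemma card_Brad_le:
  assumes "a 0 \<in> L0" "\<exists>i<k. a i \<noteq> 0"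
  shows "card (Brad m n d e k a) \<le> 2 ^ (e * (2 * (k - 1)))"
proof -
  \<comment> \<open>The coefficients of \<open>skew a\<close> by exponent: \<open>a j\<close> at
    \<open>M - j\<close> and its twist at \<open>M + j\<close>.\<close>
  define c where "c s = (if s = M then a 0 else if s < M then a (M - s) else sg s (a (s - M)))" for s
  let ?t = "M + 1 - k" and ?D = "2 * (k - 1)"
  have "skew a x = (\<Sum>s\<in>{?t..<M + k}. c s * sg s x)" for x
  proof -
    have "(\<Sum>s\<in>{?t..<M + k}. c s * sg s x)
        = c M * sg M x + (\<Sum>j\<in>{1..<k}. c (M - j) * sg (M - j) x + c (M + j) * sg (M + j) x)"
      by (rule sum_symmetric_window[OF k_pos k_le_M])
    also have "\<dots> = skew a x"
      unfolding skew_def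
      by (intro arg_cong2[of _ _ _ _ "(+)"] sum.cong) (use k_le_M in \<open>auto simp: c_def iter_mult\<close>)
    finally show ?thesis ..
  qed
  moreover have "{?t..<M + k} = {?t..?D + ?t}" using k_pos k_le_M by auto
  ultimately have skew_eq: "skew a x = (\<Sum>u\<le>?D. c (u + ?t) * sg u (sg ?t x))" for x
    using sum.shift_bounds_cl_nat_ivl[of "\<lambda>s. c s * sg s x" 0 ?t ?D]
    by (simp add: sg_sg atMost_atLeast0)
  obtain i where i: "i < k" "a i \<noteq> 0" using assms(2) by blast
  have "c (M - i) \<noteq> 0" using i k_le_M by (cases "i = 0") (auto simp: c_def)
  moreover have "M - i = (k - 1 - i) + ?t" "k - 1 - i \<le> ?D" using i k_le_M by auto
  ultimately have "card {x. (\<Sum>u\<le>?D. c (u + ?t) * sg u x) = 0} \<le> (2 ^ e) ^ ?D"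
    by (intro card_skew_kernel) (metis (no_types))
  moreover have "card (sg ?t ` Brad m n d e k a) \<le> card {x. (\<Sum>u\<le>?D. c (u + ?t) * sg u x) = 0}"
    by (rule card_mono) (auto simp: Brad_skew[of a, OF assms(1)] skew_eq)
  moreover have "card (sg ?t ` Brad m n d e k a) = card (Brad m n d e k a)"
    by (rule card_image) (rule inj_on_subset[OF inj_iter], simp)
  ultimately show ?thesis by (simp only: power_mult order.trans)
qed

section \<open>Duality between forms and bivectors\<close>

text \<open>The entries that determine the form. The further coordinate \<open>a k\<close> counted
  by \<open>beta\<close> supplies exactly the factor \<open>2 ^ m\<close> by which
  \<open>beta\<close> divides.\<close>

definition Y :: "(nat \<Rightarrow> 'a) set" where
  "Y = {a. a 0 \<in> L0 \<and> (\<forall>i\<ge>k. a i = 0)}"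

lemma Y_L0: "a \<in> Y \<Longrightarrow> a 0 \<in> L0" by (simp add: Y_def)

lemma card_L0: "card L0 = 2 ^ n"
  unfolding subfield_of_order_def
  by (rule card_fixed_frobenius[OF card_univ n_pos _ m_pos]) (simp add: m_def)

lemma finite_Y: "finite Y"
  by (rule finite_subset[OF _ finite_supported[of k]]) (auto simp: Y_def)

lemma card_Y: "card Y = 2 ^ (n + m * (k - 1))"
proof -
  let ?T = "{x :: nat \<Rightarrow> 'a. \<forall>i\<ge>k - 1. x i = 0}"
  have "bij_betw (\<lambda>(c, f) i. if i = 0 then c else f (i - 1)) (L0 \<times> ?T) Y"
    by (rule bij_betw_byWitness[where f' = "\<lambda>a. (a 0, \<lambda>i. a (Suc i))"])
       (use k_pos in \<open>auto simp: Y_def fun_eq_iff simp del: One_nat_def\<close>)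
  then have "card Y = card (L0 \<times> ?T)" by (simp only: bij_betw_same_card)
  also have "\<dots> = 2 ^ n * (2 ^ m) ^ (k - 1)"
    by (simp only: card_cartesian_product card_L0 card_supported card_univ)
  finally show ?thesis by (simp add: power_add power_mult)
qed

lemma sum_B_wedge:
  "(\<Sum>i<v. B a (x i) (y i)) = Tn (a 0 * wedge_coeff x y v M)
    + (\<Sum>j\<in>{1..<k}. Tm (a j * wedge_coeff x y v (M - j)))"
proof -
  have "(\<Sum>i<v. B a (x i) (y i)) = (\<Sum>i<v. Tn (a 0 * (x i * sg M (y i) + sg M (x i) * y i)))
      + (\<Sum>i<v. \<Sum>j\<in>{1..<k}. Tm (a j * (x i * sg (M - j) (y i) + sg (M - j) (x i) * y i)))"
    by (simp only: B_eq sum.distrib)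
  also have "(\<Sum>i<v. \<Sum>j\<in>{1..<k}. Tm (a j * (x i * sg (M - j) (y i) + sg (M - j) (x i) * y i)))
      = (\<Sum>j\<in>{1..<k}. \<Sum>i<v. Tm (a j * (x i * sg (M - j) (y i) + sg (M - j) (x i) * y i)))"
    by (rule sum.swap)
  finally show ?thesis
    by (simp only: wedge_coeff_def sum_distrib_left Tn_sum Tm_sum mult.commute[of "sg _ _"])
qed

text \<open>Nondegeneracy of the traces kills the coefficients at \<open>M\<close> and
  \<open>M - j\<close>, reflection those at \<open>M + j\<close>. What is left lies in the
  complementary cyclic window, too narrow for a nonzero wedge of \<open>v < k\<close> pairs.\<close>

lemma wedge_annihilator:
  assumes "v < k"
  shows "{y. (\<forall>i\<ge>v. y i = 0) \<and> (\<forall>a\<in>Y. (\<Sum>i<v. B a (x i) (y i)) = 0)} = wedge_kernel x v"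
proof (intro equalityI subsetI)
  fix y assume "y \<in> wedge_kernel x v"
  then show "y \<in> {y. (\<forall>i\<ge>v. y i = 0) \<and> (\<forall>a\<in>Y. (\<Sum>i<v. B a (x i) (y i)) = 0)}"
    by (auto simp: wedge_kernel_def wedge_map_0_iff sum_B_wedge Tm_eq)
next
  fix y assume "y \<in> {y. (\<forall>i\<ge>v. y i = 0) \<and> (\<forall>a\<in>Y. (\<Sum>i<v. B a (x i) (y i)) = 0)}"
  then have y: "\<forall>i\<ge>v. y i = 0" and
    ann: "\<And>a. a \<in> Y \<Longrightarrow> Tn (a 0 * wedge_coeff x y v M)
        + (\<Sum>j\<in>{1..<k}. Tm (a j * wedge_coeff x y v (M - j))) = 0"
    by (auto simp: sum_B_wedge)
  have reflect: "wedge_coeff x y v (M + j) = sg (M + j) (wedge_coeff x y v (M - j))" if "j \<le> M" for j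
  proof -
    have "2 * M - (M - j) = M + j" using that by auto
    then show ?thesis using wedge_coeff_reflect[of "M - j" x y v] by (simp add: m_div_e)
  qed
  \<comment> \<open>Reflection at \<open>j = 0\<close> puts this coefficient in \<open>L0\<close>,
    so testing with \<open>a 0 \<in> L0\<close> suffices.\<close>
  have mid: "wedge_coeff x y v M = 0"
  proof (rule Tn_nondegenerate)
    show "wedge_coeff x y v M \<in> L0" using reflect[of 0] by (simp add: L0_iff)
    fix c assume "c \<in> L0"
    then have "(\<lambda>i. if i = 0 then c else 0) \<in> Y" using k_pos by (simp add: Y_def)
    from ann[OF this] show "Tn (c * wedge_coeff x y v M) = 0" by (simp add: Tm_eq)
  qed
  have low: "wedge_coeff x y v (M - j) = 0" if j: "j \<in> {1..<k}" for j
  proof (rule Tm_nondegenerate)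
    fix c
    have "(\<lambda>i. if i = j then c else 0) \<in> Y" using j by (auto simp: Y_def L0_iff)
    from ann[OF this] have "(\<Sum>i\<in>{1..<k}. Tm ((if i = j then c else 0) * wedge_coeff x y v (M - i))) = 0"
      using j by simp
    also have "(\<Sum>i\<in>{1..<k}. Tm ((if i = j then c else 0) * wedge_coeff x y v (M - i)))
        = (\<Sum>i\<in>{1..<k}. if i = j then Tm (c * wedge_coeff x y v (M - i)) else 0)"
      by (rule sum.cong) (auto simp: Tm_eq)
    finally show "Tm (wedge_coeff x y v (M - j) * c) = 0"
      using j by (simp add: mult.commute)
  qed
  have window: "wedge_coeff x y v s = 0" if s: "M - k < s" "s < M + k" for s
  proof -
    consider "s = M" | "s < M" | "M < s" by linarith
    then show ?thesis
    proof cases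
      case 2
      then have "s = M - (M - s)" "M - s \<in> {1..<k}" using s by auto
      then show ?thesis using low by metis
    next
      case 3
      then have *: "s = M + (s - M)" "s - M \<in> {1..<k}" using s by auto
      then have "s - M \<le> M" using k_le_M by auto
      from reflect[OF this] show ?thesis using low[OF *(2)] *(1) by simp
    qed (simp add: mid)
  qed
  have "wedge_coeff x y v s = 0" for s
  \<comment> \<open>The complementary window runs from \<open>M + k\<close> to
    \<open>3 * M - k\<close>, which is \<open>M - k\<close> modulo the period \<open>2 * M\<close>;
    the bound \<open>D + 2 * v < 2 * M\<close> is then \<open>v < k\<close>.\<close>
  proof (rule wedge_coeff_window[where t = "M + k" and D = "2 * M - 2 * k"])
    fix s assume s: "M + k + (2 * M - 2 * k) < s" "s < M + k + m div e"
    then have "s = (s - 2 * M) + m div e" "M - k < s - 2 * M" "s - 2 * M < M + k"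
      using k_le_M k_pos by (auto simp: m_div_e)
    then show "wedge_coeff x y v s = 0" using window wedge_coeff_period by metis
  next
    show "2 * M - 2 * k + 2 * v < m div e" using \<open>v < k\<close> k_le_M by (simp add: m_div_e)
  qed
  then show "y \<in> wedge_kernel x v" using y by (simp add: wedge_kernel_def wedge_map_0_iff)
qed

text \<open>\<open>card_annihilators\<close> for the pairing
  \<open>\<Sum>i<v. B a (x i) (y i)\<close>: the left annihilator consists of the forms with every
  \<open>x i\<close> in the radical, the right one is \<open>wedge_kernel x v\<close>.\<close>

lemma card_Y_radical_contains:
  assumes "v < k"
  shows "card {a \<in> Y. \<forall>i<v. x i \<in> Brad m n d e k a} * 2 ^ (m * v)
    = card (wedge_kernel x v) * card Y"
proof -
  let ?T = "{y :: nat \<Rightarrow> 'a. \<forall>i\<ge>v. y i = 0}"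
  let ?b = "\<lambda>a y. \<Sum>i<v. B a (x i) (y i)"
  have B0: "B a x 0 = 0" for a x using B_eq[of a x 0] by (simp add: Tm_eq)
  have B_left: "B a x y = Tm (x * skew a y)" if "a \<in> Y" for a x y
    using B_sym B_skew[of a, OF Y_L0[OF that]] by metis
  have Y_add: "a - a' \<in> Y" if "a \<in> Y" "a' \<in> Y" for a a'
    using that by (simp add: Y_def L0_iff iter_add)
  have Y_scale: "(\<lambda>i. c * a i) \<in> Y" if "a \<in> Y" "c \<in> K" for a c
    using that by (simp add: Y_def L0_iff iter_mult iter_K)
  have b_K: "?b a y \<in> K" if "a \<in> Y" for a y
    by (rule K_sum) (simp add: B_left[OF that] Tm_in_K)
  have "card {a \<in> Y. \<forall>y\<in>?T. ?b a y = 0} * card ?T = card {y \<in> ?T. \<forall>a\<in>Y. ?b a y = 0} * card Y"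
  proof (rule card_annihilators[where q = "2 ^ e"])
    fix a assume a: "a \<in> Y" and nz: "\<exists>y\<in>?T. ?b a y \<noteq> 0"
    show "card {y \<in> ?T. ?b a y = 0} * 2 ^ e = card ?T"
    proof (rule card_functional_kernel[where f = "?b a", OF finite_supported _ _ _ _ nz])
      show "?b a (y + y') = ?b a y + ?b a y'" for y y'
        by (simp add: B_left[OF a] B_sym[of a] skew_add distrib_left Tm_add sum.distrib
            B_skew[of a, OF Y_L0[OF a]] distrib_right)
      show "\<exists>y'\<in>?T. ?b a y' = c * ?b a y" if "y \<in> ?T" "c \<in> K" for y c
        by (rule bexI[of _ "\<lambda>i. c * y i"])
           (use that in \<open>simp_all add: B_skew[of a, OF Y_L0[OF a]] mult.assoc Tm_scale sum_distrib_left\<close>)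
    qed (use b_K[OF a] in auto)
  next
    fix y assume nz: "\<exists>a\<in>Y. ?b a y \<noteq> 0"
    show "card {a \<in> Y. ?b a y = 0} * 2 ^ e = card Y"
    proof (rule card_functional_kernel[where f = "\<lambda>a. ?b a y", OF finite_Y _ _ _ _ nz])
      show "?b (a + a') y = ?b a y + ?b a' y" for a a'
        by (simp add: sum_B_wedge distrib_right Tn_add Tm_add sum.distrib add_ac)
      show "\<exists>a'\<in>Y. ?b a' y = c * ?b a y" if "a \<in> Y" "c \<in> K" for a c
        by (rule bexI[of _ "\<lambda>i. c * a i"])
           (use Y_scale[OF that] that in \<open>simp_all add: B_skew[OF Y_L0] skew_scale_coeff mult.left_commute
              Tm_scale sum_distrib_left\<close>)
    qed (use b_K Y_add in auto)
  qed (use finite_supported finite_Y q_gt_1 in simp_all)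
  moreover have "{a \<in> Y. \<forall>y\<in>?T. ?b a y = 0} = {a \<in> Y. \<forall>i<v. x i \<in> Brad m n d e k a}"
  proof (intro Collect_cong conj_cong refl iffI ballI allI impI)
    fix a i assume a: "\<forall>y\<in>?T. ?b a y = 0" and i: "i < v"
    show "x i \<in> Brad m n d e k a"
      unfolding Brad_def
    proof (intro CollectI allI)
      fix t
      \<comment> \<open>A tuple concentrated at position \<open>i\<close> isolates the single value
        \<open>B a (x i) t\<close>.\<close>
      have "(\<lambda>l. if l = i then t else 0) \<in> ?T" using i by auto
      then have "(\<Sum>l<v. B a (x l) (if l = i then t else 0)) = 0" by (rule bspec[OF a])
      also have "(\<Sum>l<v. B a (x l) (if l = i then t else 0)) = (\<Sum>l<v. if l = i then B a (x l) t else 0)"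
        by (rule sum.cong) (auto simp: B0)
      finally show "B a (x i) t = 0" using i by simp
    qed
  qed (auto simp: Brad_def)
  moreover have "{y \<in> ?T. \<forall>a\<in>Y. ?b a y = 0} = wedge_kernel x v"
    using wedge_annihilator[OF assms, of x] by simp
  ultimately show ?thesis
    by (simp only: card_supported card_univ power_mult)
qed


section \<open>Moments of the radical over all coefficient tuples\<close>

abbreviation Q :: real where "Q \<equiv> 2 ^ m"
abbreviation q :: real where "q \<equiv> 2 ^ e"

text \<open>Double counting of pairs of a form and an independent \<open>v\<close>-tuple in its
  radical. The average agrees with \<open>moment_functional_q_factorial\<close> at
  \<open>z = 1 / Q\<close>.\<close>

lemma sum_radical_independent:
  assumes "v < k"
  shows "(\<Sum>a\<in>Y. \<Prod>i<v. real (card (Brad m n d e k a)) - q ^ i)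
    = real (card Y) * (\<Prod>i<v. q ^ Suc i * (1 - q ^ i * (1 / Q)))"
proof -
  let ?R = "Brad m n d e k" and ?I = "indep_tuples UNIV v"
  let ?c = "\<lambda>a x. if \<forall>i<v. x i \<in> ?R a then 1 else (0::real)"
  have sum_R: "(\<Prod>i<v. real (card (?R a)) - q ^ i) = (\<Sum>x\<in>?I. ?c a x)" if "a \<in> Y" for a
  proof -
    have "{x \<in> ?I. \<forall>i<v. x i \<in> ?R a} = indep_tuples (?R a) v"
      by (auto simp: indep_tuples_def)
    then have "(\<Sum>x\<in>?I. ?c a x) = real (card (indep_tuples (?R a) v))"
      by (simp add: sum.If_cases finite_indep_tuples Int_def)
    then show ?thesis
      using card_indep_tuples[OF subsp_Brad[of a, OF Y_L0[OF that]], of v] by simp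
  qed
  have sum_Y: "(\<Sum>a\<in>Y. ?c a x) = (\<Prod>i<v. q ^ Suc i) * real (card Y) / Q ^ v" if "x \<in> ?I" for x
  proof -
    have "(\<Sum>a\<in>Y. ?c a x) = real (card {a \<in> Y. \<forall>i<v. x i \<in> ?R a})"
      by (simp add: sum.If_cases finite_Y Int_def)
    moreover have "real (card {a \<in> Y. \<forall>i<v. x i \<in> ?R a} * 2 ^ (m * v))
        = real ((\<Prod>i<v. (2 ^ e) ^ Suc i) * card Y)"
      using card_Y_radical_contains[OF assms, of x] card_wedge_kernel[of x v] that
      by (simp only: indep_tuples_def mem_Collect_eq)
    then have "real (card {a \<in> Y. \<forall>i<v. x i \<in> ?R a}) * Q ^ v = (\<Prod>i<v. q ^ Suc i) * real (card Y)"
      by (simp only: of_nat_mult of_nat_power of_nat_prod of_nat_numeral power_mult)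
    then have "real (card {a \<in> Y. \<forall>i<v. x i \<in> ?R a}) = (\<Prod>i<v. q ^ Suc i) * real (card Y) / Q ^ v"
      by (simp add: eq_divide_eq)
    ultimately show ?thesis by simp
  qed
  have "(\<Sum>a\<in>Y. \<Prod>i<v. real (card (?R a)) - q ^ i) = (\<Sum>a\<in>Y. \<Sum>x\<in>?I. ?c a x)"
    by (rule sum.cong) (simp_all only: sum_R)
  also have "\<dots> = (\<Sum>x\<in>?I. \<Sum>a\<in>Y. ?c a x)" by (rule sum.swap)
  also have "\<dots> = (\<Sum>x\<in>?I. (\<Prod>i<v. q ^ Suc i) * real (card Y) / Q ^ v)"
    by (rule sum.cong) (simp_all only: sum_Y)
  also have "\<dots> = real (card ?I) * ((\<Prod>i<v. q ^ Suc i) * real (card Y) / Q ^ v)"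
    by (simp only: sum_constant)
  also have "real (card ?I) = (\<Prod>i<v. Q - q ^ i)"
    using card_indep_tuples[OF subsp_UNIV, of v] by (simp add: card_univ)
  also have "(\<Prod>i<v. Q - q ^ i) = (\<Prod>i<v. Q * (1 - q ^ i * (1 / Q)))"
    by (rule prod.cong) (simp_all add: right_diff_distrib)
  also have "\<dots> = Q ^ v * (\<Prod>i<v. 1 - q ^ i * (1 / Q))"
    by (simp only: prod.distrib prod_constant card_lessThan)
  finally show ?thesis by (simp add: prod.distrib)
qed

text \<open>The average over \<open>Y\<close> and \<open>moment_functional\<close> agree on the
  basis with roots \<open>q ^ i\<close> up to degree \<open>k - 1\<close>, hence also on the product
  with even roots.\<close>

lemma sum_radical_even:
  assumes "v < k"
  shows "(\<Sum>a\<in>Y. \<Prod>i<v. real (card (Brad m n d e k a)) - q ^ (2 * i))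
    = real (card Y) * (q ^ v * (\<Prod>i<v. 1 - q ^ (2 * i) * (1 / Q)))"
proof -
  let ?X = "\<lambda>a. real (card (Brad m n d e k a))"
  let ?F = "\<lambda>P. \<Sum>a\<in>Y. poly P (?X a)"
  let ?G = "\<lambda>P. real (card Y) * moment_functional q (1 / Q) P"
  let ?r = "\<Prod>i<v. [:-(q ^ (2 * i)), 1:]"
  have "?F ?r = ?G ?r"
  proof (rule linear_functionals_agree[where F = ?F and G = ?G])
    show "degree (\<Prod>i<u. [:-(q ^ i), 1:]) = u \<and> coeff (\<Prod>i<u. [:-(q ^ i), 1:]) u = 1
        \<and> ?F (\<Prod>i<u. [:-(q ^ i), 1:]) = ?G (\<Prod>i<u. [:-(q ^ i), 1:])" if "u \<le> k - 1" for u
    proof (intro conjI)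
      have "u < k" using that k_pos by simp
      then show "?F (\<Prod>i<u. [:-(q ^ i), 1:]) = ?G (\<Prod>i<u. [:-(q ^ i), 1:])"
        using sum_radical_independent[of u]
        by (simp only: moment_functional_q_factorial poly_prod poly_pCons poly_0 mult_zero_right
            add_0_right mult_1_right uminus_add_conv_diff)
    qed (rule degree_root_prod coeff_root_prod)+
    show "degree ?r \<le> k - 1" using assms degree_root_prod[of "\<lambda>i. q ^ (2 * i)" v] by simp
  qed (simp_all only: poly_add poly_smult sum.distrib sum_distrib_left moment_functional_add
        moment_functional_smult distrib_left mult.left_commute)
  then show ?thesis
    by (simp only: moment_functional_sq_factorial poly_prod poly_pCons poly_0 mult_zero_right
        add_0_right mult_1_right uminus_add_conv_diff)
qed

definition num_rad :: "nat \<Rightarrow> nat" where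
  "num_rad j = card {a \<in> Y. (\<exists>i<k. a i \<noteq> 0) \<and> card (Brad m n d e k a) = 2 ^ (e * (2 * j))}"

lemma pow_eq_iff: "(2::nat) ^ (e * (2 * i)) = 2 ^ (e * (2 * j)) \<longleftrightarrow> i = j"
  using e_pos by simp

lemma card_Brad_nonzero:
  assumes "a 0 \<in> L0" "\<exists>i<k. a i \<noteq> 0"
  obtains j where "j \<le> k - 1" "card (Brad m n d e k a) = 2 ^ (e * (2 * j))"
proof -
  obtain j where j: "card (Brad m n d e k a) = 2 ^ (e * (2 * j))"
    using card_Brad_parity[of a, OF assms(1)] by blast
  then have "(2::nat) ^ (e * (2 * j)) \<le> 2 ^ (e * (2 * (k - 1)))"
    using card_Brad_le[of a, OF assms] by simp
  then have "j \<le> k - 1" using e_pos by simp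
  then show thesis using j by (rule that)
qed

text \<open>The zero tuple, whose radical is the whole field, is separated; it is the source of the
  \<open>- 1\<close> in the final formula.\<close>

lemma sum_over_Y:
  fixes g :: "nat \<Rightarrow> real"
  shows "(\<Sum>a\<in>Y. g (card (Brad m n d e k a)))
    = g (2 ^ m) + (\<Sum>j\<le>k - 1. real (num_rad j) * g (2 ^ (e * (2 * j))))"
proof -
  let ?R = "\<lambda>a. card (Brad m n d e k a)"
  define Y' where "Y' = {a \<in> Y. \<exists>i<k. a i \<noteq> 0}"
  have Y: "Y = insert (\<lambda>_. 0) Y'"
    by (auto simp: Y_def Y'_def L0_iff fun_eq_iff) (meson not_le)
  have fin: "finite Y'" using finite_Y by (simp add: Y'_def)
  have "(\<lambda>_. 0) \<in> Y" by (simp add: Y_def L0_iff)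
  then have "Brad m n d e k (\<lambda>_. 0 :: 'a) = UNIV"
    using Brad_skew[of "\<lambda>_. 0"] by (simp add: skew_def L0_iff)
  then have R0: "?R (\<lambda>_. 0 :: 'a) = 2 ^ m" by (simp add: card_univ)
  have single: "g (?R a) = (\<Sum>j\<le>k - 1. if ?R a = 2 ^ (e * (2 * j)) then g (2 ^ (e * (2 * j))) else 0)"
    if "a \<in> Y'" for a
  proof -
    have "a 0 \<in> L0" "\<exists>i<k. a i \<noteq> 0" using that by (auto simp: Y'_def Y_def)
    then obtain j where j: "j \<le> k - 1" "?R a = 2 ^ (e * (2 * j))"
      by (rule card_Brad_nonzero)
    have "(\<Sum>i\<le>k - 1. if ?R a = 2 ^ (e * (2 * i)) then g (2 ^ (e * (2 * i))) else 0)
        = (\<Sum>i\<le>k - 1. if j = i then g (2 ^ (e * (2 * i))) else 0)"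
      by (simp only: j(2) pow_eq_iff)
    then show ?thesis using j by simp
  qed
  have "(\<Sum>a\<in>Y'. g (?R a))
      = (\<Sum>a\<in>Y'. \<Sum>j\<le>k - 1. if ?R a = 2 ^ (e * (2 * j)) then g (2 ^ (e * (2 * j))) else 0)"
    by (rule sum.cong) (simp_all only: single)
  also have "\<dots> = (\<Sum>j\<le>k - 1. \<Sum>a\<in>Y'. if ?R a = 2 ^ (e * (2 * j)) then g (2 ^ (e * (2 * j))) else 0)"
    by (rule sum.swap)
  also have "\<dots> = (\<Sum>j\<le>k - 1. real (num_rad j) * g (2 ^ (e * (2 * j))))"
  proof (rule sum.cong)
    fix j
    have "Y' \<inter> {a. ?R a = 2 ^ (e * (2 * j))}
        = {a \<in> Y. (\<exists>i<k. a i \<noteq> 0) \<and> ?R a = 2 ^ (e * (2 * j))}"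
      by (auto simp: Y'_def)
    then show "(\<Sum>a\<in>Y'. if ?R a = 2 ^ (e * (2 * j)) then g (2 ^ (e * (2 * j))) else 0)
        = real (num_rad j) * g (2 ^ (e * (2 * j)))"
      by (simp only: sum.If_cases[OF fin] num_rad_def) simp
  qed simp
  moreover have "(\<lambda>_. 0) \<notin> Y'" by (simp add: Y'_def)
  ultimately show ?thesis using fin by (simp add: Y R0)
qed

lemma m_eq: "m = e * (2 * M)"
  using m_div_e e_dvd(2) by (metis dvd_mult_div_cancel)

text \<open>In base \<open>4 ^ e = q ^ 2\<close> both evaluations of the even-root average carry the
  common factor \<open>?C\<close>. Cancelling it leaves the binomial moments; the zero form moves to
  the right as \<open>- 1\<close>.\<close>

lemma num_rad_moments:
  assumes "v \<le> k - 1"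
  shows "(\<Sum>j\<le>k - 1. real (num_rad j) * gauss_binom (4 ^ e) j v)
    = gauss_binom (4 ^ e) M v * (2 ^ (n * (2 * k - 1 - 2 * v) + e * v) - 1)"
proof -
  let ?b = "4 ^ e :: real"
  have b1: "?b > 1" by (rule one_less_power) (use e_pos in simp_all)
  have b: "?b = q ^ 2" by (simp add: power2_eq_square flip: power_mult_distrib)
  have b_pow: "q ^ (2 * i) = ?b ^ i" for i by (simp only: b power_mult)
  have Qb: "Q = ?b ^ M" by (simp only: m_eq b power_mult)
  let ?C = "(\<Prod>i<v. ?b ^ i) * gauss_fact ?b v"
  let ?S = "\<Sum>j\<le>k - 1. real (num_rad j) * gauss_binom ?b j v"
  have "?C \<noteq> 0" using gauss_fact_nonzero[OF b1] by simp
  have "v < k" using assms k_pos by simp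
  have pr: "(\<Prod>i<v. ?b ^ j - ?b ^ i) = ?C * gauss_binom ?b j v" for j
    by (rule prod_power_diff_gauss_binom[OF b1])
  have "(\<Sum>a\<in>Y. \<Prod>i<v. real (card (Brad m n d e k a)) - q ^ (2 * i))
      = (\<Prod>i<v. real (2 ^ m) - q ^ (2 * i))
        + (\<Sum>j\<le>k - 1. real (num_rad j) * (\<Prod>i<v. real (2 ^ (e * (2 * j))) - q ^ (2 * i)))"
    by (rule sum_over_Y)
  also have "\<dots> = (\<Prod>i<v. ?b ^ M - ?b ^ i) + (\<Sum>j\<le>k - 1. real (num_rad j) * (\<Prod>i<v. ?b ^ j - ?b ^ i))"
  proof -
    have "real (2 ^ (e * (2 * j))) = ?b ^ j" for j
      by (simp only: of_nat_power of_nat_numeral power_mult b)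
    then show ?thesis by (simp only: b_pow of_nat_power of_nat_numeral Qb)
  qed
  also have "\<dots> = ?C * (gauss_binom ?b M v + ?S)"
    unfolding pr by (simp only: distrib_left sum_distrib_left mult.left_commute)
  finally have "?C * (gauss_binom ?b M v + ?S)
      = real (card Y) * (q ^ v * (\<Prod>i<v. 1 - ?b ^ i * (1 / Q)))"
    using sum_radical_even[OF \<open>v < k\<close>] by (simp only: b_pow)
  also have "(\<Prod>i<v. 1 - ?b ^ i * (1 / Q)) = (\<Prod>i<v. (?b ^ M - ?b ^ i) / Q)"
    by (rule prod.cong) (simp_all only: Qb diff_divide_distrib, simp_all)
  also have "\<dots> = ?C * gauss_binom ?b M v / Q ^ v"
    by (simp only: prod_dividef pr prod_constant card_lessThan)
  also have "real (card Y) * (q ^ v * (?C * gauss_binom ?b M v / Q ^ v))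
      = ?C * (gauss_binom ?b M v * (real (card Y) * q ^ v / Q ^ v))"
    by simp
  finally have "gauss_binom ?b M v + ?S = gauss_binom ?b M v * (real (card Y) * q ^ v / Q ^ v)"
    using \<open>?C \<noteq> 0\<close> mult_left_cancel by blast
  moreover have "real (card Y) * q ^ v / Q ^ v = 2 ^ (n * (2 * k - 1 - 2 * v) + e * v)"
  proof -
    \<comment> \<open>Writing \<open>k = Suc (v + w)\<close> removes the truncated subtractions from
      the exponent identity.\<close>
    obtain w where w: "k = Suc (v + w)" using \<open>v < k\<close> less_imp_Suc_add by blast
    then have "2 * k - 1 - 2 * v = 2 * w + 1" by simp
    moreover have "n + m * (k - 1) + e * v = n * (2 * w + 1) + e * v + m * v"
      by (simp add: w m_def algebra_simps)
    ultimately have "real (card Y) * q ^ v = 2 ^ (n * (2 * k - 1 - 2 * v) + e * v) * Q ^ v"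
      by (simp only: card_Y of_nat_power of_nat_numeral power_mult[symmetric] power_add[symmetric])
    then show ?thesis by simp
  qed
  ultimately show ?thesis by (simp add: right_diff_distrib)
qed

section \<open>From radicals to the rank distribution\<close>

lemma Brad_cong:
  fixes a a' :: "nat \<Rightarrow> 'a"
  assumes "\<And>i. i < k \<Longrightarrow> a i = a' i"
  shows "Brad m n d e k a = Brad m n d e k a'"
proof -
  have "B a x y = B a' x y" for x y
    unfolding B_eq using assms k_pos by (intro arg_cong2[of _ _ _ _ "(+)"] sum.cong) auto
  then show ?thesis by (simp only: Brad_def)
qed

text \<open>Both radical dimensions stay below \<open>2 * M\<close> because
  \<open>k \<le> M\<close>, so the natural-number subtraction loses nothing.\<close>

lemma Brank_eq_iff:
  assumes "a 0 \<in> L0" "\<exists>i<k. a i \<noteq> 0" "j < k"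
  shows "Brank m n d e k a = m div e - 2 * j \<longleftrightarrow> card (Brad m n d e k a) = 2 ^ (e * (2 * j))"
proof -
  obtain i where i: "i \<le> k - 1" "card (Brad m n d e k a) = 2 ^ (e * (2 * i))"
    using card_Brad_nonzero[of a, OF assms(1,2)] by blast
  have "dim_over (2 ^ e) (Brad m n d e k a) = 2 * i"
    unfolding dim_over_def i(2)
    by (rule the_equality) (use e_pos in \<open>auto simp flip: power_mult\<close>)
  then have "Brank m n d e k a = 2 * M - 2 * i" by (simp add: Brank_def m_div_e)
  then show ?thesis
    using i assms(3) k_le_M by (auto simp: m_div_e pow_eq_iff)
qed

text \<open>Each tuple of \<open>Y\<close> extends by an arbitrary value at \<open>k\<close> with
  the same radical, which gives \<open>2 ^ m\<close> extensions and cancels the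
  normalization.\<close>

lemma beta_eq:
  assumes "j < k"
  shows "beta field_type m n d e k (m div e - 2 * j) = real (num_rad j)"
proof -
  let ?S = "{a \<in> Y. (\<exists>i<k. a i \<noteq> 0) \<and> card (Brad m n d e k a) = 2 ^ (e * (2 * j))}"
  let ?T = "{a :: nat \<Rightarrow> 'a. a 0 \<in> L0 \<and> (\<forall>i>k. a i = 0) \<and>
      Brank m n d e k a = m div e - 2 * j \<and> (\<exists>i<k. a i \<noteq> 0)}"
  have T: "?T = {a. a 0 \<in> L0 \<and> (\<forall>i>k. a i = 0) \<and> (\<exists>i<k. a i \<noteq> 0) \<and>
      card (Brad m n d e k a) = 2 ^ (e * (2 * j))}"
    using Brank_eq_iff[OF _ _ assms] by blast
  have upd: "Brad m n d e k (a(k := c)) = Brad m n d e k a" for a :: "nat \<Rightarrow> 'a" and c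
    by (rule Brad_cong) simp
  have ex: "(\<exists>i<k. (a(k := c)) i \<noteq> 0) \<longleftrightarrow> (\<exists>i<k. a i \<noteq> 0)" for a :: "nat \<Rightarrow> 'a" and c
    by auto
  have "bij_betw (\<lambda>(a, c). a(k := c)) (?S \<times> UNIV) ?T"
    unfolding T
  proof (rule bij_betw_byWitness[where f' = "\<lambda>a. (a(k := 0), a k)"])
    show "(\<lambda>(a, c). a(k := c)) ` (?S \<times> UNIV) \<subseteq> {a. a 0 \<in> L0 \<and> (\<forall>i>k. a i = 0) \<and>
        (\<exists>i<k. a i \<noteq> 0) \<and> card (Brad m n d e k a) = 2 ^ (e * (2 * j))}"
      using k_pos by (clarsimp simp only: mem_Collect_eq upd ex Y_def) auto
    show "(\<lambda>a. (a(k := 0), a k)) ` {a. a 0 \<in> L0 \<and> (\<forall>i>k. a i = 0) \<and>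
        (\<exists>i<k. a i \<noteq> 0) \<and> card (Brad m n d e k a) = 2 ^ (e * (2 * j))} \<subseteq> ?S \<times> UNIV"
      using k_pos by (clarsimp simp only: mem_Collect_eq upd ex Y_def) auto
  qed (auto simp: Y_def fun_eq_iff)
  then have "card ?T = num_rad j * 2 ^ m"
    by (simp only: bij_betw_same_card[symmetric] card_cartesian_product num_rad_def card_univ)
  then show ?thesis by (simp add: beta_def)
qed

text \<open>Gaussian inversion of \<open>num_rad_moments\<close>, with \<open>v\<close> ranging up
  to \<open>k - 1\<close>.\<close>

lemma beta_formula:
  assumes "j < k"
  shows "beta field_type m n d e k (m div e - 2 * j) =
    (\<Sum>v=j..k-1. (-1) ^ (v - j) * 4 ^ (e * ((v - j) choose 2))
        * gauss_binom (4 ^ e) v j * gauss_binom (4 ^ e) (m div (2 * e)) v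
        * (2 ^ (n * (2 * k - 1 - 2 * v) + e * v) - 1))"
proof -
  have b1: "(4 ^ e :: real) > 1" by (rule one_less_power) (use e_pos in simp_all)
  have "m div (2 * e) = M" by (simp add: m_def M_def)
  moreover have "real (num_rad j) = (\<Sum>v=j..k-1. (-1) ^ (v - j) * (4 ^ e) ^ ((v - j) choose 2)
      * gauss_binom (4 ^ e) v j
      * (gauss_binom (4 ^ e) M v * (2 ^ (n * (2 * k - 1 - 2 * v) + e * v) - 1)))"
    using b1 num_rad_moments assms by (intro gauss_inversion[where \<alpha> = "\<lambda>j. real (num_rad j)"]) auto
  ultimately show ?thesis
    by (simp only: beta_eq[OF assms] power_mult mult.assoc)
qed

end

theorem theorem8p2:
  fixes m n d e k j :: nat
  assumes "card (UNIV :: 'a::{field,finite} set) = 2 ^ m"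
    and "0 < m" "0 < n" "0 < d" "0 < e" "0 < k"
    and "m = 2 * n" "e = gcd n d" "e = gcd m d"
    and "1 \<le> k" "k \<le> n div e"
    and "j < k"
  shows "beta TYPE('a) m n d e k (m div e - 2 * j) =
    (\<Sum>v=j..k-1. (-1) ^ (v - j) * 4 ^ (e * ((v - j) choose 2))
        * gauss_binom (4 ^ e) v j * gauss_binom (4 ^ e) (m div (2 * e)) v
        * (2 ^ (n * (2 * k - 1 - 2 * v) + e * v) - 1))"
proof -
  interpret twisted_forms m n d e k "TYPE('a)"
    by (rule twisted_forms.intro) fact+
  show ?thesis by (rule beta_formula) fact
qed

end
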